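(* Let $\{\mu_i\}_{i\in\mathcal V}$ be any family of graph-directed self-similar measures on $\mathbb{R}^d$ associated with a finite connected directed multigraph (no separation condition is assumed). Then the $L^q$-spectrum of each $\mu_i$ exists for all $q\ge 0$ and is the same for each measure $\mu_i$; that is, for all $q\geq 0$ and all $i,j\in\mathcal V$, \[ \underline{\tau}_{\mu_i}(q)=\overline{\tau}_{\mu_i}(q)=\underline{\tau}_{\mu_j}(q)=\overline{\tau}_{\mu_j}(q). \]
   Context: Graph-directed self-similar measures: Let $\Gamma=(\mathcal V,\mathcal E)$ be a finite connected directed multigraph with vertices $\mathcal V=\{1,\dots,N\}$ and a finite multiset of edges $\mathcal E$. Write $\mathcal E_{i,j}$ for the multiset of all edges joining the vertex $i$ to the vertex $j$. To each $e\in\mathcal E$ associate a contracting similarity $S_e:\mathbb{R}^d\to\mathbb{R}^d$ with similarity ratio $c_e\in(0,1)$ and a probability $p_e\in(0,1)$ such that $\sum_{j=1}^N\sum_{e\in\mathcal E_{i,j}}p_e=1$ for all $i\in\mathcal V$. There is a unique family of non-empty compact sets $\{F_i\}_{i\in\mathcal V}$ with $F_i=\bigcup_{j=1}^N\bigcup_{e\in\mathcal E_{i,j}}S_e(F_j)$ and a unique family of Borel probability measures $\{\mu_i\}_{i\in\mathcal V}$ with $\mu_i=\sum_{j=1}^N\sum_{e\in\mathcal E_{i,j}}p_e\,\mu_j\circ S_e^{-1}$, and $\operatorname{supp}\mu_i=F_i$. The measures $\{\mu_i\}_{i\in\mathcal V}$ are called a family of graph-directed self-similar measures. $L^q$-spectrum: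 for a compactly supported Borel probability measure $\mu$ on $\mathbb{R}^d$ and $q\in\mathbb{R}$, \[ \underline{\tau}_\mu(q)=\liminf_{\delta\to0}\frac{\log\int_{\operatorname{supp}\mu}\mu(B(x,\delta))^{q-1}\,d\mu(x)}{-\log\delta},\qquad \overline{\tau}_\mu(q)=\limsup_{\delta\to0}\frac{\log\int_{\operatorname{supp}\mu}\mu(B(x,\delta))^{q-1}\,d\mu(x)}{-\log\delta}. \] The $L^q$-spectrum exists at $q$ if these two values coincide. *)

theory Defs
  imports "HOL-Probability.Probability" "Graph_Theory.Digraph_Component"
begin

text \<open>
  A finite directed multigraph is a \<^locale>\<open>fin_digraph\<close>, which allows loops and parallel arcs;
  an arc \<open>e\<close> leads from \<open>tail G e\<close> to \<open>head G e\<close>.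
\<close>

definition arcs_from_to :: "('v, 'e) pre_digraph \<Rightarrow> 'v \<Rightarrow> 'v \<Rightarrow> 'e set" where
  "arcs_from_to G i j = {e \<in> arcs G. tail G e = i \<and> head G e = j}"

definition similarity_map :: "real \<Rightarrow> ('a::metric_space \<Rightarrow> 'a) \<Rightarrow> bool" where
  "similarity_map c f \<longleftrightarrow> (\<forall>x y. dist (f x) (f y) = c * dist x y)"

text \<open>
  Connectedness of the directed graph means that every vertex can be reached from every other one
  along a directed path. With connectedness of the underlying undirected graph only, the measures
  at different vertices would in general have different \<open>L\<^sup>q\<close>-spectra.
\<close>

locale graph_directed_ifs = fin_digraph G
  for G :: "(nat, 'e) pre_digraph" +
  fixes N :: nat
    and S :: "'e \<Rightarrow> real ^ 'd \<Rightarrow> real ^ 'd"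
    and c :: "'e \<Rightarrow> real"
    and p :: "'e \<Rightarrow> real"
  assumes verts_eq: "verts G = {1..N}"
    and connected: "strongly_connected G"
    and ratio: "\<And>e. e \<in> arcs G \<Longrightarrow> 0 < c e \<and> c e < 1"
    and similarity: "\<And>e. e \<in> arcs G \<Longrightarrow> similarity_map (c e) (S e)"
    and prob: "\<And>e. e \<in> arcs G \<Longrightarrow> 0 < p e \<and> p e < 1"
    and prob_sum: "\<And>i. i \<in> verts G \<Longrightarrow> (\<Sum>j = 1..N. \<Sum>e \<in> arcs_from_to G i j. p e) = 1"

definition graph_directed_self_similar_measures ::
  "(nat, 'e) pre_digraph \<Rightarrow> nat \<Rightarrow> ('e \<Rightarrow> real ^ 'd \<Rightarrow> real ^ 'd) \<Rightarrow> ('e \<Rightarrow> real)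
     \<Rightarrow> (nat \<Rightarrow> (real ^ 'd) measure) \<Rightarrow> bool" where
  "graph_directed_self_similar_measures G N S p \<mu> \<longleftrightarrow>
     (\<forall>i \<in> verts G. prob_space (\<mu> i) \<and> sets (\<mu> i) = sets borel) \<and>
     (\<forall>i \<in> verts G. \<forall>A \<in> sets borel.
        measure (\<mu> i) A = (\<Sum>j = 1..N. \<Sum>e \<in> arcs_from_to G i j. p e * measure (\<mu> j) (S e -` A)))"

definition measure_support :: "'a::metric_space measure \<Rightarrow> 'a set" where
  "measure_support M = {x. \<forall>r > 0. emeasure M (ball x r) > 0}"

text \<open>
  For a compactly supported probability measure and \<open>\<delta> > 0\<close>, the integrand below is bounded on the
  support: finitely many balls of radius \<open>\<delta> / 2\<close> centred in the support cover it, so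
  \<open>measure M (cball x \<delta>)\<close> is bounded away from \<open>0\<close> there. Hence the Bochner integral is
  the usual integral, for every real \<open>q\<close>. Closed balls are used; since the closed \<open>\<delta>\<close>-ball lies
  between the open balls of radius \<open>\<delta>\<close> and \<open>2 * \<delta>\<close>, open balls give the same lower and upper
  spectra.
\<close>

definition Lq_integral :: "'a::metric_space measure \<Rightarrow> real \<Rightarrow> real \<Rightarrow> real" where
  "Lq_integral M q \<delta> = (LINT x : measure_support M | M. measure M (cball x \<delta>) powr (q - 1))"

definition lower_Lq_spectrum :: "'a::metric_space measure \<Rightarrow> real \<Rightarrow> ereal" where
  "lower_Lq_spectrum M q = Liminf (at_right 0) (\<lambda>\<delta>. ereal (ln (Lq_integral M q \<delta>) / (- ln \<delta>)))"

definition upper_Lq_spectrum :: "'a::metric_space measure \<Rightarrow> real \<Rightarrow> ereal" where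
  "upper_Lq_spectrum M q = Limsup (at_right 0) (\<lambda>\<delta>. ereal (ln (Lq_integral M q \<delta>) / (- ln \<delta>)))"

end

theory Submission
  imports Defs "HOL-Real_Asymp.Real_Asymp"
begin

text \<open>
  The integral of \<open>\<mu>(B(x,\<delta>))\<^sup>q\<close> against Lebesgue measure in \<open>x\<close> replaces the dyadic sums of Peres and
  Solomyak: it is invariant under isometries, monotone in \<open>\<delta>\<close>, changes by at most a constant factor
  when \<open>\<delta>\<close> is doubled, and scales exactly under similarities. Decomposing \<open>\<mu>\<^sub>i\<close> into pieces
  of diameter about \<open>r\<close> and applying Jensen's inequality to the pieces near a given point shows that this
  moment at scale \<open>r\<epsilon>\<close> is, up to a constant, at most (\<open>q \<ge> 1\<close>) or at least (\<open>q \<le> 1\<close>) the product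
  of the moments at scales \<open>r\<close> and \<open>\<epsilon>\<close>; strong connectedness makes the moments at different
  vertices comparable. Fekete's lemma then gives a common growth exponent.

  By Fubini, the moment is comparable to \<open>\<delta>\<^sup>d\<close> times the integral in the \<open>L\<^sup>q\<close>-spectrum.
  Only the upper bound of the moment for \<open>q < 1\<close> is delicate: a small ball may be adjacent to a much
  heavier one. The polynomial lower bound on the masses of balls limits the length of a chain of
  doublings to \<open>O(log (1/\<delta>))\<close>, so only a logarithmic factor is lost, which does not affect exponents.
\<close>

section \<open>Weighted power means\<close>

text \<open>Overlaps between pieces are harmless because the number of pieces never enters. Near a
  point \<open>x\<close> only the total weight \<open>P\<close> of the pieces whose centres lie
  within a fixed multiple of \<open>r\<close> matters, and \<open>P\<close> is squeezed between the
  masses of two balls around \<open>x\<close> with radii comparable to \<open>r\<close>. The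
  direction of Jensen's inequality changes at \<open>q = 1\<close>; each \<open>q\<close> therefore
  gets one of the two multiplicative inequalities, and one is all that Fekete's lemma asks for.
  Every piece contributes a factor \<open>r ^ d\<close> by scaling, and integrating the local
  estimate over \<open>x\<close> produces the same power on the other side, so no power of
  \<open>r\<close> survives in the final inequality. The attractors are represented by one common
  ball around the origin that carries every measure of the family. Exponents are limits in the
  extended reals, so an infinite infimum in Fekete's lemma is covered as well.\<close>

lemma powr_le_tangent:
  fixes u q :: real
  assumes "0 \<le> u" "0 \<le> q" "q \<le> 1"
  shows "u powr q \<le> q * u + (1 - q)"
proof (cases "u = 0")
  case False
  then show ?thesis
    using Youngs_inequality_0[of q "1 - q" u 1] assms by simp
qed (use assms in auto)

text \<open>This is the concave bound with exponent \<open>1 / q\<close> at the point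
  \<open>u powr q\<close>, solved for \<open>u powr q\<close>.\<close>

lemma powr_ge_tangent:
  fixes u q :: real
  assumes "0 \<le> u" "1 \<le> q"
  shows "q * u + (1 - q) \<le> u powr q"
proof -
  have "u = (u powr q) powr (1 / q)"
    using assms by (simp add: powr_powr)
  also have "\<dots> \<le> (1 / q) * u powr q + (1 - 1 / q)"
    using assms by (intro powr_le_tangent) auto
  finally have "q * u \<le> q * ((1 / q) * u powr q + (1 - 1 / q))"
    using assms by (intro mult_left_mono) auto
  also have "\<dots> = u powr q + (q - 1)"
    using assms by (simp add: field_simps)
  finally show ?thesis
    by simp
qed

lemma sum_powr_scaled:
  fixes a x :: "'i \<Rightarrow> real"
  assumes "\<And>i. i \<in> A \<Longrightarrow> 0 \<le> x i" and "0 < m"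
  shows "(\<Sum>i\<in>A. a i * x i powr q) = m powr q * (\<Sum>i\<in>A. a i * (x i / m) powr q)"
  unfolding sum_distrib_left
proof (rule sum.cong[OF refl])
  fix i assume "i \<in> A"
  have "x i powr q = (m * (x i / m)) powr q"
    using assms by simp
  also have "\<dots> = m powr q * (x i / m) powr q"
    using assms \<open>i \<in> A\<close> by (subst powr_mult) auto
  finally show "a i * x i powr q = m powr q * (a i * (x i / m) powr q)"
    by simp
qed

text \<open>With tangents taken at the weighted mean \<open>m\<close> the first-order terms cancel
  in the sum. Summing the pointwise tangent bounds therefore gives Jensen's inequality.\<close>

lemma sum_tangent_at_mean:
  fixes a x :: "'i \<Rightarrow> real"
  assumes "sum a A > 0" "(\<Sum>i\<in>A. a i * x i) > 0"
  defines "m \<equiv> (\<Sum>i\<in>A. a i * x i) / sum a A"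
  shows "(\<Sum>i\<in>A. a i * (q * (x i / m) + (1 - q))) = sum a A"
proof -
  have "(\<Sum>i\<in>A. a i * (q * (x i / m) + (1 - q))) = q / m * (\<Sum>i\<in>A. a i * x i) + (1 - q) * sum a A"
    by (simp add: algebra_simps sum.distrib sum_distrib_left sum_distrib_right sum_subtractf)
  also have "q / m * (\<Sum>i\<in>A. a i * x i) = q * sum a A"
    using assms by (simp add: m_def)
  finally show ?thesis
    by (simp add: algebra_simps)
qed

lemma mean_powr_mult:
  fixes M P q :: real
  assumes "0 < M" "0 < P"
  shows "(M / P) powr q * P = M powr q * P powr (1 - q)"
  using assms by (simp add: powr_divide powr_diff)

text \<open>Jensen's inequality for a concave power with weights of arbitrary total
  \<open>P\<close>: normalising them costs \<open>1 / P\<close> on the left and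
  \<open>P powr q\<close> on the right, which combine to \<open>P powr (q - 1)\<close>.\<close>

lemma sum_powr_le_powr_sum:
  fixes a x :: "'i \<Rightarrow> real"
  assumes "finite A" "\<And>i. i \<in> A \<Longrightarrow> 0 \<le> a i" "\<And>i. i \<in> A \<Longrightarrow> 0 \<le> x i"
    and q: "0 \<le> q" "q \<le> 1"
  shows "sum a A powr (q - 1) * (\<Sum>i\<in>A. a i * x i powr q) \<le> (\<Sum>i\<in>A. a i * x i) powr q"
proof (cases "(\<Sum>i\<in>A. a i * x i) = 0")
  case True
  then have "\<forall>i\<in>A. a i * x i = 0"
    using assms by (subst (asm) sum_nonneg_eq_0_iff) auto
  \<comment> \<open>In each term \<open>a i = 0\<close> or \<open>x i = 0\<close>, and
    \<open>0 powr q = 0\<close> also for \<open>q = 0\<close>.\<close>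
  then have "(\<Sum>i\<in>A. a i * x i powr q) = 0"
    by (intro sum.neutral) auto
  then show ?thesis
    by simp
next
  case False
  define P M where "P = sum a A" and "M = (\<Sum>i\<in>A. a i * x i)"
  have M: "M > 0"
    using False assms unfolding M_def by (simp add: less_le sum_nonneg)
  have P: "P > 0"
  proof -
    have "P \<noteq> 0"
      using False assms unfolding P_def by (subst sum_nonneg_eq_0_iff) (auto intro!: sum.neutral)
    then show ?thesis
      using assms unfolding P_def by (simp add: less_le sum_nonneg)
  qed
  have "(\<Sum>i\<in>A. a i * x i powr q) = (M / P) powr q * (\<Sum>i\<in>A. a i * (x i / (M / P)) powr q)"
    using assms M P by (intro sum_powr_scaled) auto
  also have "\<dots> \<le> (M / P) powr q * (\<Sum>i\<in>A. a i * (q * (x i / (M / P)) + (1 - q)))"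
    using assms M P by (intro mult_left_mono sum_mono powr_le_tangent) auto
  also have "\<dots> = M powr q * P powr (1 - q)"
    using sum_tangent_at_mean[of a A x q] M P mean_powr_mult by (simp add: M_def P_def)
  finally have "P powr (q - 1) * (\<Sum>i\<in>A. a i * x i powr q) \<le> P powr (q - 1) * (M powr q * P powr (1 - q))"
    by (intro mult_left_mono) auto
  also have "\<dots> = M powr q * (P powr (q - 1) * P powr (1 - q))"
    by simp
  also have "P powr (q - 1) * P powr (1 - q) = 1"
    using P by (simp flip: powr_add)
  finally show ?thesis
    by (simp add: M_def P_def)
qed

lemma powr_sum_le_sum_powr:
  fixes a x :: "'i \<Rightarrow> real"
  assumes "finite A" "\<And>i. i \<in> A \<Longrightarrow> 0 \<le> a i" "\<And>i. i \<in> A \<Longrightarrow> 0 \<le> x i"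
    and q: "1 \<le> q"
  shows "(\<Sum>i\<in>A. a i * x i) powr q \<le> sum a A powr (q - 1) * (\<Sum>i\<in>A. a i * x i powr q)"
proof (cases "(\<Sum>i\<in>A. a i * x i) = 0")
  case True
  then show ?thesis
    using assms by (auto intro!: mult_nonneg_nonneg sum_nonneg)
next
  case False
  define P M where "P = sum a A" and "M = (\<Sum>i\<in>A. a i * x i)"
  have M: "M > 0"
    using False assms unfolding M_def by (simp add: less_le sum_nonneg)
  have P: "P > 0"
  proof -
    have "P \<noteq> 0"
      using False assms unfolding P_def by (subst sum_nonneg_eq_0_iff) (auto intro!: sum.neutral)
    then show ?thesis
      using assms unfolding P_def by (simp add: less_le sum_nonneg)
  qed
  have "M powr q * P powr (1 - q) = (M / P) powr q * (\<Sum>i\<in>A. a i * (q * (x i / (M / P)) + (1 - q)))"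
    using sum_tangent_at_mean[of a A x q] M P mean_powr_mult by (simp add: M_def P_def)
  also have "\<dots> \<le> (M / P) powr q * (\<Sum>i\<in>A. a i * (x i / (M / P)) powr q)"
    using assms M P by (intro mult_left_mono sum_mono powr_ge_tangent) auto
  also have "\<dots> = (\<Sum>i\<in>A. a i * x i powr q)"
    using assms M P by (intro sum_powr_scaled[symmetric]) auto
  finally have "P powr (q - 1) * (M powr q * P powr (1 - q)) \<le> P powr (q - 1) * (\<Sum>i\<in>A. a i * x i powr q)"
    by (intro mult_left_mono) auto
  moreover have "P powr (q - 1) * (M powr q * P powr (1 - q)) = M powr q * (P powr (q - 1) * P powr (1 - q))"
    by simp
  moreover have "P powr (q - 1) * P powr (1 - q) = 1"
    using P by (simp flip: powr_add)
  ultimately have "M powr q \<le> P powr (q - 1) * (\<Sum>i\<in>A. a i * x i powr q)"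
    by (simp only: mult_1_right)
  then show ?thesis
    by (simp add: M_def P_def)
qed

text \<open>Splits off the one factor of mass that comes from integrating over a ball against the
  measure itself. At \<open>m = 0\<close> both sides are 0 for every \<open>q\<close>, since
  \<open>0 powr q = 0\<close>.\<close>

lemma powr_eq_mult_powr_pred: "(m::real) \<ge> 0 \<Longrightarrow> m powr q = m powr (q - 1) * m"
  by (cases "m = 0") (auto simp: powr_diff)

lemma ennreal_mult_sum_mult:
  assumes "0 \<le> a" "\<And>i. i \<in> A \<Longrightarrow> 0 \<le> f i" "\<And>i. i \<in> A \<Longrightarrow> 0 \<le> g i"
  shows "ennreal (a * (\<Sum>i\<in>A. f i * g i)) = ennreal a * (\<Sum>i\<in>A. ennreal (f i) * ennreal (g i))"
proof -
  have "(\<Sum>i\<in>A. ennreal (f i) * ennreal (g i)) = (\<Sum>i\<in>A. ennreal (f i * g i))"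
    using assms by (intro sum.cong refl ennreal_mult[symmetric]) auto
  also have "\<dots> = ennreal (\<Sum>i\<in>A. f i * g i)"
    using assms by (intro sum_ennreal) auto
  finally show ?thesis
    using assms by (simp add: ennreal_mult sum_nonneg)
qed

section \<open>Lebesgue measure under similarities\<close>

lemma nn_integral_lborel_translation:
  fixes h :: "'a::euclidean_space \<Rightarrow> ennreal"
  assumes [measurable]: "h \<in> borel_measurable borel"
  shows "(\<integral>\<^sup>+x. h (t + x) \<partial>lborel) = (\<integral>\<^sup>+x. h x \<partial>lborel)"
proof -
  have "(\<integral>\<^sup>+x. h x \<partial>lborel) = (\<integral>\<^sup>+x. h x \<partial>distr lborel borel ((+) t))"
    by (simp add: lborel_distr_plus)
  also have "\<dots> = (\<integral>\<^sup>+x. h (t + x) \<partial>lborel)"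
    by (subst nn_integral_distr) auto
  finally show ?thesis ..
qed

text \<open>
  Evaluating the volume of \<open>{(x, y). norm x < 1 \<and> x + g y \<in> B}\<close> in both orders of integration
  avoids the change-of-variables theorem, which the library has only for well-ordered index types.
\<close>
lemma lborel_distr_orthogonal:
  fixes g :: "'a::euclidean_space \<Rightarrow> 'a"
  assumes g: "orthogonal_transformation g"
  shows "distr lborel borel g = lborel"
proof (rule measure_eqI)
  fix B assume "B \<in> sets (distr lborel borel g)"
  then have B[measurable]: "B \<in> sets borel"
    by simp
  have lin: "linear g"
    using g by (rule orthogonal_transformation_linear)
  have "continuous_on UNIV g"
    using lin by (rule linear_continuous_on[OF linear_conv_bounded_linear[THEN iffD1]])
  then have [measurable]: "g \<in> borel_measurable borel"
    by (rule borel_measurable_continuous_onI)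
  obtain g' where g': "\<And>x. g (g' x) = x"
    using orthogonal_transformation_surj[OF g] by (metis surj_f_inv_f)
  define A where "A = ball (0::'a) 1"
  have [measurable]: "A \<in> sets borel"
    by (simp add: A_def)
  define \<Lambda> where "\<Lambda> = emeasure lborel A"
  have "\<Lambda> > 0"
    unfolding \<Lambda>_def A_def by (simp add: emeasure_ball unit_ball_vol_pos)
  have "\<Lambda> < \<infinity>"
    unfolding \<Lambda>_def A_def by (simp add: emeasure_ball)
  have "\<Lambda> * emeasure lborel (g -` B) = (\<integral>\<^sup>+x. indicator A x * emeasure lborel (g -` B) \<partial>lborel)"
    by (subst nn_integral_multc) (auto simp: \<Lambda>_def)
  also have "\<dots> = (\<integral>\<^sup>+x. indicator A x * (\<integral>\<^sup>+y. indicator B (x + g y) \<partial>lborel) \<partial>lborel)"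
  proof (rule nn_integral_cong)
    fix x :: 'a
    have "(\<integral>\<^sup>+y. indicator B (x + g y) \<partial>lborel) = (\<integral>\<^sup>+y. indicator B (g (g' x + y)) \<partial>lborel)"
      by (simp add: linear_add[OF lin] g')
    also have "\<dots> = (\<integral>\<^sup>+y. indicator B (g y) \<partial>lborel)"
      by (rule nn_integral_lborel_translation) measurable
    also have "\<dots> = (\<integral>\<^sup>+y. indicator (g -` B) y \<partial>lborel)"
      by (intro nn_integral_cong) (auto simp: indicator_def)
    also have "\<dots> = emeasure lborel (g -` B)"
      using measurable_sets[OF \<open>g \<in> borel_measurable borel\<close> B] by (intro nn_integral_indicator) auto
    finally show "indicator A x * emeasure lborel (g -` B) = indicator A x * (\<integral>\<^sup>+y. indicator B (x + g y) \<partial>lborel)"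
      by simp
  qed
  also have "\<dots> = (\<integral>\<^sup>+x. (\<integral>\<^sup>+y. indicator A x * indicator B (x + g y) \<partial>lborel) \<partial>lborel)"
    by (intro nn_integral_cong nn_integral_cmult[symmetric]) measurable
  also have "\<dots> = (\<integral>\<^sup>+y. (\<integral>\<^sup>+x. indicator A x * indicator B (x + g y) \<partial>lborel) \<partial>lborel)"
    by (intro lborel_pair.Fubini') measurable
  also have "\<dots> = (\<integral>\<^sup>+y. (\<integral>\<^sup>+x. indicator A (x - g y) * indicator B x \<partial>lborel) \<partial>lborel)"
  proof (rule nn_integral_cong)
    fix y
    show "(\<integral>\<^sup>+x. indicator A x * indicator B (x + g y) \<partial>lborel) = (\<integral>\<^sup>+x. indicator A (x - g y) * indicator B x \<partial>lborel)"
      using nn_integral_lborel_translation[of "\<lambda>x. indicator A (x - g y) * indicator B x" "g y"]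
      by (simp add: add.commute)
  qed
  also have "\<dots> = (\<integral>\<^sup>+x. (\<integral>\<^sup>+y. indicator A (x - g y) * indicator B x \<partial>lborel) \<partial>lborel)"
    by (intro lborel_pair.Fubini') measurable
  also have "\<dots> = (\<integral>\<^sup>+x. \<Lambda> * indicator B x \<partial>lborel)"
  proof (rule nn_integral_cong)
    fix x :: 'a
    \<comment> \<open>As \<open>g\<close> is an isometry, the admissible \<open>y\<close> form a
      unit ball around the preimage of \<open>x\<close>. The inner integral is thus the same
      constant \<Lambda> for every \<open>x\<close>, and it can be cancelled at the end.\<close>
    have "indicator A (x - g y) = (indicator (ball (g' x) 1) y :: ennreal)" for y
    proof -
      have "norm (x - g y) = norm (g' x - y)"
        by (metis g' linear_diff[OF lin] orthogonal_transformation_norm[OF g])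
      then show ?thesis
        by (simp add: A_def indicator_def dist_norm norm_minus_commute)
    qed
    then have "(\<integral>\<^sup>+y. indicator A (x - g y) \<partial>lborel) = emeasure lborel (ball (g' x) 1)"
      by simp
    also have "\<dots> = \<Lambda>"
      by (simp add: \<Lambda>_def A_def emeasure_ball)
    finally show "(\<integral>\<^sup>+y. indicator A (x - g y) * indicator B x \<partial>lborel) = \<Lambda> * indicator B x"
      by (subst nn_integral_multc) auto
  qed
  also have "\<dots> = \<Lambda> * emeasure lborel B"
    by (subst nn_integral_cmult) auto
  finally have "emeasure lborel (g -` B) = emeasure lborel B"
    using \<open>\<Lambda> > 0\<close> \<open>\<Lambda> < \<infinity>\<close> by (auto simp: ennreal_mult_cancel_left)
  then show "emeasure (distr lborel borel g) B = emeasure lborel B"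
    by (simp add: emeasure_distr)
qed simp

text \<open>Removing the value at 0 and the ratio leaves an isometry that fixes the origin, and such
  a map is linear.\<close>

lemma similarity_map_decompose:
  fixes f :: "'a::euclidean_space \<Rightarrow> 'a"
  assumes "similarity_map c f" "0 < c"
  obtains g where "orthogonal_transformation g" "\<And>x. f x = f 0 + c *\<^sub>R g x"
proof
  define g where "g = (\<lambda>x. (1 / c) *\<^sub>R (f x - f 0))"
  have "dist (g x) (g y) = dist x y" for x y
  proof -
    have "g x - g y = (1 / c) *\<^sub>R (f x - f y)"
      by (simp add: g_def algebra_simps)
    then have "dist (g x) (g y) = (1 / c) * dist (f x) (f y)"
      using assms by (simp add: dist_norm)
    then show ?thesis
      using assms by (simp add: similarity_map_def)
  qed
  moreover have "g 0 = 0"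
    by (simp add: g_def)
  ultimately show "orthogonal_transformation g"
    unfolding orthogonal_transformation_isometry by blast
  show "f x = f 0 + c *\<^sub>R g x" for x
    using assms by (simp add: g_def)
qed

text \<open>The distance condition alone yields only injectivity; surjectivity comes from finite
  dimension, through the orthogonal part.\<close>

lemma similarity_map_surj:
  fixes f :: "'a::euclidean_space \<Rightarrow> 'a"
  assumes "similarity_map c f" "0 < c"
  shows "surj f"
proof -
  obtain g where g: "orthogonal_transformation g" "\<And>x. f x = f 0 + c *\<^sub>R g x"
    using similarity_map_decompose[OF assms] by blast
  have "y \<in> range f" for y
  proof -
    obtain x where "(1 / c) *\<^sub>R (y - f 0) = g x"
      using orthogonal_transformation_surj[OF g(1)] by (metis surjD)
    then have "c *\<^sub>R g x = c *\<^sub>R ((1 / c) *\<^sub>R (y - f 0))"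
      by simp
    also have "\<dots> = y - f 0"
      using assms by simp
    finally have "f x = y"
      by (subst g(2)) simp
    then show ?thesis
      by blast
  qed
  then show ?thesis
    by blast
qed

lemma similarity_map_measurable:
  fixes f :: "'a::euclidean_space \<Rightarrow> 'a"
  assumes "similarity_map c f" "0 < c"
  shows "f \<in> borel_measurable borel"
proof -
  have "continuous_on UNIV f"
    unfolding continuous_on_iff
  proof (intro ballI allI impI)
    fix x and e :: real assume "0 < e"
    then show "\<exists>d>0. \<forall>x'\<in>UNIV. dist x' x < d \<longrightarrow> dist (f x') (f x) < e"
      using assms by (intro exI[of _ "e / c"]) (auto simp: similarity_map_def field_simps)
  qed
  then show ?thesis
    by (rule borel_measurable_continuous_onI)
qed

lemma similarity_map_vimage_cball:
  assumes "similarity_map c f" "0 < c"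
  shows "f -` cball (f y) s = cball y (s / c)"
  using assms by (auto simp: similarity_map_def field_simps)

text \<open>Turns the mass of a preimage of a ball into an ordinary ball mass, with the centre moved
  by the inverse similarity \<open>g\<close>.\<close>

lemma similarity_map_inverse:
  fixes f :: "'a::euclidean_space \<Rightarrow> 'a"
  assumes f: "similarity_map c f" "0 < c"
  obtains g where "similarity_map (1 / c) g" "\<And>z s. f -` cball z s = cball (g z) (s / c)"
proof
  define g where "g = inv f"
  have g: "f (g z) = z" for z
    unfolding g_def using similarity_map_surj[OF f] by (rule surj_f_inv_f)
  have "dist (g x) (g y) = 1 / c * dist x y" for x y
  proof -
    have "dist (f (g x)) (f (g y)) = c * dist (g x) (g y)"
      using f(1) unfolding similarity_map_def by blast
    then show ?thesis
      using f(2) by (simp add: g)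
  qed
  then show "similarity_map (1 / c) g"
    unfolding similarity_map_def by blast
  show "f -` cball z s = cball (g z) (s / c)" for z s
    using similarity_map_vimage_cball[OF f, of "g z" s] by (simp add: g)
qed

lemma nn_integral_lborel_similarity:
  fixes f :: "'a::euclidean_space \<Rightarrow> 'a" and h :: "'a \<Rightarrow> ennreal"
  assumes f: "similarity_map c f" "0 < c" and [measurable]: "h \<in> borel_measurable borel"
  shows "(\<integral>\<^sup>+x. h x \<partial>lborel) = ennreal (c ^ DIM('a)) * (\<integral>\<^sup>+x. h (f x) \<partial>lborel)"
proof -
  obtain g where g: "orthogonal_transformation g" "\<And>x. f x = f 0 + c *\<^sub>R g x"
    using similarity_map_decompose[OF f] by blast
  have "continuous_on UNIV g"
    using orthogonal_transformation_linear[OF g(1)]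
    by (rule linear_continuous_on[OF linear_conv_bounded_linear[THEN iffD1]])
  then have [measurable]: "g \<in> borel_measurable borel"
    by (rule borel_measurable_continuous_onI)
  have "(\<integral>\<^sup>+x. h x \<partial>lborel)
      = (\<integral>\<^sup>+x. h x \<partial>density (distr lborel borel (\<lambda>x. f 0 + c *\<^sub>R x)) (\<lambda>_. \<bar>c\<bar> ^ DIM('a)))"
    using f(2) by (subst lborel_affine[of c "f 0"]) auto
  also have "\<dots> = ennreal (c ^ DIM('a)) * (\<integral>\<^sup>+x. h (f 0 + c *\<^sub>R x) \<partial>lborel)"
    using f(2) by (simp add: nn_integral_density nn_integral_distr nn_integral_cmult)
  also have "(\<integral>\<^sup>+x. h (f 0 + c *\<^sub>R x) \<partial>lborel) = (\<integral>\<^sup>+x. h (f 0 + c *\<^sub>R x) \<partial>distr lborel borel g)"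
    by (simp add: lborel_distr_orthogonal[OF g(1)])
  also have "\<dots> = (\<integral>\<^sup>+x. h (f x) \<partial>lborel)"
    by (subst nn_integral_distr) (auto simp flip: g(2))
  finally show ?thesis .
qed

section \<open>Moments of ball masses\<close>

text \<open>
  Because \<open>0 powr 0 = 0\<close>, for \<open>q = 0\<close> this is the volume of the \<open>\<delta>\<close>-neighbourhood of the support.
\<close>
definition ball_moment :: "'a::euclidean_space measure \<Rightarrow> real \<Rightarrow> real \<Rightarrow> ennreal" where
  "ball_moment M q \<delta> = (\<integral>\<^sup>+x. ennreal (measure M (cball x \<delta>) powr q) \<partial>lborel)"

definition cball_volume :: "'a::euclidean_space itself \<Rightarrow> real \<Rightarrow> real" where
  "cball_volume _ r = unit_ball_vol (real DIM('a)) * r ^ DIM('a)"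

lemma emeasure_lborel_cball_eq:
  "0 \<le> r \<Longrightarrow> emeasure lborel (cball (x::'a::euclidean_space) r) = ennreal (cball_volume TYPE('a) r)"
  by (simp add: cball_volume_def emeasure_cball)

lemma cball_volume_pos: "0 < r \<Longrightarrow> 0 < cball_volume TYPE('a::euclidean_space) r"
  by (simp add: cball_volume_def unit_ball_vol_pos)

lemma cball_volume_mult:
  "cball_volume TYPE('a::euclidean_space) (s * r) = s ^ DIM('a) * cball_volume TYPE('a) r"
  by (simp add: cball_volume_def power_mult_distrib)

lemma indicator_cball_measurable [measurable]:
  "(\<lambda>z :: 'a::euclidean_space \<times> 'a. indicator (cball (fst z) \<rho>) (snd z) :: ennreal) \<in> borel_measurable (borel \<Otimes>\<^sub>M borel)"
proof -
  have "closed {z :: 'a \<times> 'a. dist (fst z) (snd z) \<le> \<rho>}"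
    by (intro closed_Collect_le continuous_intros)
  then have "{z :: 'a \<times> 'a. dist (fst z) (snd z) \<le> \<rho>} \<in> sets (borel \<Otimes>\<^sub>M borel)"
    by (metis borel_closed borel_prod)
  then have "(indicator {z :: 'a \<times> 'a. dist (fst z) (snd z) \<le> \<rho>} :: _ \<Rightarrow> ennreal) \<in> borel_measurable (borel \<Otimes>\<^sub>M borel)"
    by simp
  also have "indicator {z :: 'a \<times> 'a. dist (fst z) (snd z) \<le> \<rho>} = (\<lambda>z. indicator (cball (fst z) \<rho>) (snd z) :: ennreal)"
    by (auto simp: indicator_def)
  finally show ?thesis .
qed

text \<open>Fubini and the symmetry of \<open>y \<in> cball x \<rho>\<close>: the centres of the
  balls containing \<open>y\<close> fill a ball of radius \<rho>. This passes from local to global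
  estimates, and it serves both for the probability measures and for
  \<open>M = lborel\<close>.\<close>

lemma nn_integral_ball_average:
  fixes h :: "'a::euclidean_space \<Rightarrow> ennreal"
  assumes "sigma_finite_measure M" and [measurable_cong]: "sets M = sets borel"
    and [measurable]: "h \<in> borel_measurable borel" and "0 \<le> \<rho>"
  shows "(\<integral>\<^sup>+x. (\<integral>\<^sup>+y. indicator (cball x \<rho>) y * h y \<partial>M) \<partial>lborel)
    = ennreal (cball_volume TYPE('a) \<rho>) * (\<integral>\<^sup>+y. h y \<partial>M)"
proof -
  interpret pair_sigma_finite lborel M
    using assms(1) by (intro pair_sigma_finite.intro sigma_finite_lborel)
  have "(\<integral>\<^sup>+x. (\<integral>\<^sup>+y. indicator (cball x \<rho>) y * h y \<partial>M) \<partial>lborel)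
      = (\<integral>\<^sup>+y. (\<integral>\<^sup>+x. indicator (cball x \<rho>) y * h y \<partial>lborel) \<partial>M)"
    by (intro Fubini'[symmetric]) measurable
  also have "\<dots> = (\<integral>\<^sup>+y. ennreal (cball_volume TYPE('a) \<rho>) * h y \<partial>M)"
  proof (rule nn_integral_cong)
    fix y :: 'a
    have "(\<lambda>x. indicator (cball x \<rho>) y :: ennreal) = indicator (cball y \<rho>)"
      by (auto simp: indicator_def dist_commute)
    then have "(\<integral>\<^sup>+x. indicator (cball x \<rho>) y * h y \<partial>lborel) = (\<integral>\<^sup>+x. indicator (cball y \<rho>) x * h y \<partial>lborel)"
      by metis
    also have "\<dots> = ennreal (cball_volume TYPE('a) \<rho>) * h y"
      using assms by (subst nn_integral_multc) (simp_all add: emeasure_lborel_cball_eq borel_measurable_indicator)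
    finally show "(\<integral>\<^sup>+x. indicator (cball x \<rho>) y * h y \<partial>lborel) = ennreal (cball_volume TYPE('a) \<rho>) * h y" .
  qed
  also have "\<dots> = ennreal (cball_volume TYPE('a) \<rho>) * (\<integral>\<^sup>+y. h y \<partial>M)"
    by (intro nn_integral_cmult) measurable
  finally show ?thesis .
qed

locale borel_prob_space = prob_space M for M :: "'a::euclidean_space measure" +
  assumes sets_M [measurable_cong]: "sets M = sets borel"
begin

lemma space_M: "space M = UNIV"
  using sets_eq_imp_space_eq[OF sets_M] by simp

text \<open>The ball mass is the mass of the section at \<open>x\<close> of a closed subset of the
  product space.\<close>

lemma measurable_measure_cball [measurable]: "(\<lambda>x. measure M (cball x \<delta>)) \<in> borel_measurable borel"
proof -
  define Q where "Q = {z :: 'a \<times> 'a. dist (fst z) (snd z) \<le> \<delta>}"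
  have "closed Q"
    unfolding Q_def by (intro closed_Collect_le continuous_intros)
  then have "Q \<in> sets (borel \<Otimes>\<^sub>M borel)"
    by (metis borel_closed borel_prod)
  then have "Q \<in> sets (borel \<Otimes>\<^sub>M M)"
    by (simp add: sets_pair_measure_cong[OF refl sets_M])
  then have "(\<lambda>x. emeasure M (Pair x -` Q)) \<in> borel_measurable borel"
    by (rule measurable_emeasure_Pair)
  moreover have "Pair x -` Q = cball x \<delta>" for x
    by (auto simp: Q_def)
  ultimately have "(\<lambda>x. emeasure M (cball x \<delta>)) \<in> borel_measurable borel"
    by simp
  then show ?thesis
    unfolding measure_def by simp
qed

lemma measure_cball_mono:
  "cball x \<delta> \<subseteq> cball y \<delta>' \<Longrightarrow> measure M (cball x \<delta>) \<le> measure M (cball y \<delta>')"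
  by (intro finite_measure_mono) (auto simp: sets_M)

lemma ball_moment_mono:
  assumes "0 \<le> q" "\<delta> \<le> \<delta>'"
  shows "ball_moment M q \<delta> \<le> ball_moment M q \<delta>'"
  unfolding ball_moment_def using assms
  by (intro nn_integral_mono ennreal_leI powr_mono2 measure_cball_mono) auto

text \<open>Finitely many unit balls cover \<open>cball 0 K\<close>; scaled by \<delta> and
  translated, they cover every ball of radius \<open>K * \<delta>\<close>. Each covering ball is
  centred at a fixed translate of \<open>x\<close>, which Lebesgue measure does not notice. Hence
  the moment is doubling even when \<open>M\<close> is not.\<close>

lemma ball_moment_doubling:
  assumes q: "0 \<le> q" and K: "0 < K"
  shows "\<exists>C>0. \<forall>\<delta>>0. ball_moment M q (K * \<delta>) \<le> ennreal C * ball_moment M q \<delta>"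
proof -
  obtain A :: "'a set" where A: "finite A" "cball 0 K \<subseteq> (\<Union>a\<in>A. ball a 1)"
  proof -
    have "compact (cball (0::'a) K)" "\<And>x. x \<in> cball (0::'a) K \<Longrightarrow> open (ball x 1)"
      "cball (0::'a) K \<subseteq> (\<Union>x\<in>cball 0 K. ball x 1)"
      by (auto intro: centre_in_ball[THEN iffD2])
    then show ?thesis
      by (rule compactE_image[of "cball 0 K" "cball 0 K" "\<lambda>x. ball x 1"]) (use that in auto)
  qed
  define n where "n = real (card A)"
  have "A \<noteq> {}"
    using A(2) K by (auto dest: subsetD[of _ _ 0])
  then have n: "n > 0"
    using A(1) by (simp add: n_def card_gt_0_iff)
  show ?thesis
  proof (intro exI[of _ "n powr q * n"] conjI allI impI)
    fix \<delta> :: real assume \<delta>: "0 < \<delta>"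
    have pointwise: "measure M (cball x (K * \<delta>)) powr q
      \<le> n powr q * (\<Sum>a\<in>A. measure M (cball (\<delta> *\<^sub>R a + x) \<delta>) powr q)" for x
    proof -
      define f where "f a = measure M (cball (\<delta> *\<^sub>R a + x) \<delta>)" for a
      have "cball x (K * \<delta>) \<subseteq> (\<Union>a\<in>A. cball (\<delta> *\<^sub>R a + x) \<delta>)"
      proof
        fix y assume "y \<in> cball x (K * \<delta>)"
        then have "norm ((1 / \<delta>) *\<^sub>R (y - x)) \<le> K"
          using \<delta> by (simp add: dist_norm norm_minus_commute pos_divide_le_eq)
        then have "(1 / \<delta>) *\<^sub>R (y - x) \<in> cball 0 K"
          by simp
        then obtain a where a: "a \<in> A" "(1 / \<delta>) *\<^sub>R (y - x) \<in> ball a 1"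
          using A(2) by blast
        have "\<delta> *\<^sub>R a + x - y = \<delta> *\<^sub>R (a - (1 / \<delta>) *\<^sub>R (y - x))"
          using \<delta> by (simp add: algebra_simps)
        then have "dist (\<delta> *\<^sub>R a + x) y = \<delta> * dist a ((1 / \<delta>) *\<^sub>R (y - x))"
          using \<delta> by (simp add: dist_norm)
        also have "\<dots> \<le> \<delta> * 1"
          using a \<delta> by (intro mult_left_mono) auto
        finally show "y \<in> (\<Union>a\<in>A. cball (\<delta> *\<^sub>R a + x) \<delta>)"
          using a by auto
      qed
      then have "measure M (cball x (K * \<delta>)) \<le> measure M (\<Union>a\<in>A. cball (\<delta> *\<^sub>R a + x) \<delta>)"
        by (intro finite_measure_mono) (auto simp: sets_M A)
      also have "\<dots> \<le> (\<Sum>a\<in>A. f a)"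
        unfolding f_def by (intro measure_UNION_le) (auto simp: sets_M A)
      finally have *: "measure M (cball x (K * \<delta>)) \<le> (\<Sum>a\<in>A. f a)" .
      \<comment> \<open>Bounding the sum by \<open>n\<close> times its largest term, and the power
        of that term by the sum of all powers, treats \<open>q < 1\<close> and
        \<open>q \<ge> 1\<close> together.\<close>
      obtain b where b: "b \<in> A" "f b = Max (f ` A)"
        using A(1) \<open>A \<noteq> {}\<close> by (metis (mono_tags, lifting) Max_in finite_imageI image_iff image_is_empty)
      have "(\<Sum>a\<in>A. f a) \<le> n * f b"
        unfolding n_def using b A(1) by (intro sum_bounded_above) auto
      with * have "measure M (cball x (K * \<delta>)) powr q \<le> (n * f b) powr q"
        using q by (intro powr_mono2) auto
      also have "\<dots> = n powr q * f b powr q"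
        using n by (subst powr_mult) (auto simp: f_def)
      also have "\<dots> \<le> n powr q * (\<Sum>a\<in>A. f a powr q)"
        using b A(1) by (intro mult_left_mono member_le_sum) auto
      finally show ?thesis
        by (simp add: f_def)
    qed
    have "ball_moment M q (K * \<delta>)
      \<le> (\<integral>\<^sup>+x. ennreal (n powr q) * (\<Sum>a\<in>A. ennreal (measure M (cball (\<delta> *\<^sub>R a + x) \<delta>) powr q)) \<partial>lborel)"
      unfolding ball_moment_def
    proof (rule nn_integral_mono)
      fix x
      have "ennreal (measure M (cball x (K * \<delta>)) powr q)
          \<le> ennreal (n powr q * (\<Sum>a\<in>A. measure M (cball (\<delta> *\<^sub>R a + x) \<delta>) powr q))"
        by (intro ennreal_leI pointwise)
      also have "\<dots> = ennreal (n powr q) * (\<Sum>a\<in>A. ennreal (measure M (cball (\<delta> *\<^sub>R a + x) \<delta>) powr q))"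
        by (simp add: ennreal_mult' sum_ennreal)
      finally show "ennreal (measure M (cball x (K * \<delta>)) powr q)
          \<le> ennreal (n powr q) * (\<Sum>a\<in>A. ennreal (measure M (cball (\<delta> *\<^sub>R a + x) \<delta>) powr q))" .
    qed
    also have "\<dots> = ennreal (n powr q) * (\<Sum>a\<in>A. \<integral>\<^sup>+x. ennreal (measure M (cball (\<delta> *\<^sub>R a + x) \<delta>) powr q) \<partial>lborel)"
      by (subst nn_integral_cmult) (auto simp: nn_integral_sum simp del: sum_ennreal)
    also have "\<dots> = ennreal (n powr q) * (\<Sum>a\<in>A. ball_moment M q \<delta>)"
      unfolding ball_moment_def
      by (subst nn_integral_lborel_translation[where h = "\<lambda>x. ennreal (measure M (cball x \<delta>) powr q)"]) auto
    also have "\<dots> = ennreal (n powr q * n) * ball_moment M q \<delta>"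
      using n by (simp add: n_def ennreal_mult ennreal_of_nat_eq_real_of_nat mult.assoc)
    finally show "ball_moment M q (K * \<delta>) \<le> ennreal (n powr q * n) * ball_moment M q \<delta>" .
  qed (use n in auto)
qed

section \<open>The support carries the whole mass\<close>

lemma emeasure_support_compl: "emeasure M (- measure_support M) = 0" and closed_support: "closed (measure_support M)"
proof -
  define F where "F = {ball x r | x r. 0 < r \<and> emeasure M (ball x r) = 0}"
  have eq: "- measure_support M = \<Union>F"
  proof (intro equalityI subsetI)
    fix x assume "x \<in> \<Union>F"
    then obtain z r where zr: "x \<in> ball z r" "emeasure M (ball z r) = 0"
      by (auto simp: F_def)
    obtain e where e: "e > 0" "ball x e \<subseteq> ball z r"
      using zr(1) open_ball openE by blast
    then have "emeasure M (ball x e) \<le> 0"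
      using zr(2) emeasure_mono[OF e(2), of M] by (simp add: sets_M)
    then show "x \<in> - measure_support M"
      using e(1) by (auto simp: measure_support_def)
  next
    fix x assume "x \<in> - measure_support M"
    then obtain r where "0 < r" "emeasure M (ball x r) = 0"
      by (auto simp: measure_support_def)
    then show "x \<in> \<Union>F"
      unfolding F_def by (intro UnionI[of "ball x r"]) auto
  qed
  have "open S" if "S \<in> F" for S
    using that by (auto simp: F_def)
  \<comment> \<open>The complement of the support is a union of possibly uncountably many null
    balls; Lindelof's theorem reduces it to a countable union.\<close>
  then obtain F' where F': "F' \<subseteq> F" "countable F'" "\<Union>F' = \<Union>F"
    using Lindelof by metis
  have "(\<Union>S\<in>F'. S) \<in> null_sets M"
    using F' by (intro null_sets_UN') (auto simp: F_def sets_M null_sets_def)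
  then show "emeasure M (- measure_support M) = 0"
    using eq F' by (simp add: null_sets_def)
  have "open (- measure_support M)"
    unfolding eq using \<open>\<And>S. S \<in> F \<Longrightarrow> open S\<close> by blast
  then show "closed (measure_support M)"
    by (simp add: closed_def)
qed

lemma AE_in_support: "AE y in M. y \<in> measure_support M"
  by (rule AE_I[of _ _ "- measure_support M"])
     (use closed_support emeasure_support_compl in \<open>auto simp: sets_M\<close>)

lemma AE_measure_cball_pos:
  assumes "0 < \<delta>"
  shows "AE y in M. 0 < measure M (cball y \<delta>)"
  using AE_in_support
proof eventually_elim
  case (elim y)
  then have "0 < emeasure M (ball y \<delta>)"
    using assms by (auto simp: measure_support_def)
  also have "\<dots> \<le> emeasure M (cball y \<delta>)"
    by (intro emeasure_mono) (auto simp: sets_M)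
  finally show ?case
    by (simp add: emeasure_eq_measure)
qed

text \<open>Both sides are 0 if the integral diverges, so the identity holds unconditionally.
  Finiteness is obtained later, by comparison with the moment.\<close>

lemma Lq_integral_eq_nn_integral:
  "Lq_integral M q \<delta> = enn2real (\<integral>\<^sup>+y. ennreal (measure M (cball y \<delta>) powr (q - 1)) \<partial>M)"
proof -
  have [measurable]: "measure_support M \<in> sets borel"
    using closed_support by simp
  have "Lq_integral M q \<delta>
      = enn2real (\<integral>\<^sup>+y. ennreal (indicator (measure_support M) y *\<^sub>R measure M (cball y \<delta>) powr (q - 1)) \<partial>M)"
    unfolding Lq_integral_def set_lebesgue_integral_def
    by (intro integral_eq_nn_integral) auto
  also have "(\<integral>\<^sup>+y. ennreal (indicator (measure_support M) y *\<^sub>R measure M (cball y \<delta>) powr (q - 1)) \<partial>M)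
      = (\<integral>\<^sup>+y. ennreal (measure M (cball y \<delta>) powr (q - 1)) \<partial>M)"
    using AE_in_support by (intro nn_integral_cong_AE) (auto elim!: eventually_mono)
  finally show ?thesis .
qed

section \<open>Moments versus the integral in the \<open>L^q\<close>-spectrum\<close>

lemma nn_integral_cball_le:
  assumes "\<And>y. y \<in> cball x \<rho> \<Longrightarrow> h y \<le> B"
  shows "(\<integral>\<^sup>+y. indicator (cball x \<rho>) y * h y \<partial>M) \<le> B * ennreal (measure M (cball x \<rho>))"
proof -
  have "(\<integral>\<^sup>+y. indicator (cball x \<rho>) y * h y \<partial>M) \<le> (\<integral>\<^sup>+y. B * indicator (cball x \<rho>) y \<partial>M)"
    using assms by (intro nn_integral_mono) (auto simp: indicator_def)
  also have "\<dots> = B * emeasure M (cball x \<rho>)"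
    by (intro nn_integral_cmult_indicator) (simp add: sets_M)
  finally show ?thesis
    by (simp add: emeasure_eq_measure)
qed

lemma le_nn_integral_cball:
  assumes "AE y in M. y \<in> cball x \<rho> \<longrightarrow> B \<le> h y"
  shows "B * ennreal (measure M (cball x \<rho>)) \<le> (\<integral>\<^sup>+y. indicator (cball x \<rho>) y * h y \<partial>M)"
proof -
  have "B * ennreal (measure M (cball x \<rho>)) = (\<integral>\<^sup>+y. B * indicator (cball x \<rho>) y \<partial>M)"
    by (subst nn_integral_cmult_indicator) (auto simp add: sets_M emeasure_eq_measure)
  also have "\<dots> \<le> (\<integral>\<^sup>+y. indicator (cball x \<rho>) y * h y \<partial>M)"
    using assms by (intro nn_integral_mono_AE) (auto simp: indicator_def elim!: eventually_mono)
  finally show ?thesis .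
qed

text \<open>For \<open>y\<close> in \<open>cball x \<delta>\<close> the ball of radius
  \<open>2 * \<delta>\<close> around \<open>y\<close> contains \<open>cball x \<delta>\<close>, and
  the power \<open>q - 1\<close> is increasing. The remaining factor of mass becomes the inner
  integral over \<open>y\<close>.\<close>

lemma ball_moment_le_of_one_le:
  assumes "1 \<le> q" "0 < \<delta>"
  shows "ball_moment M q \<delta> \<le> ennreal (cball_volume TYPE('a) \<delta>)
    * (\<integral>\<^sup>+y. ennreal (measure M (cball y (2 * \<delta>)) powr (q - 1)) \<partial>M)"
proof -
  have "ball_moment M q \<delta> \<le> (\<integral>\<^sup>+x. (\<integral>\<^sup>+y. indicator (cball x \<delta>) y
      * ennreal (measure M (cball y (2 * \<delta>)) powr (q - 1)) \<partial>M) \<partial>lborel)"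
    unfolding ball_moment_def
  proof (rule nn_integral_mono)
    fix x
    have "ennreal (measure M (cball x \<delta>) powr q)
        = ennreal (measure M (cball x \<delta>) powr (q - 1)) * ennreal (measure M (cball x \<delta>))"
      by (subst powr_eq_mult_powr_pred) (auto simp: ennreal_mult)
    also have "\<dots> \<le> (\<integral>\<^sup>+y. indicator (cball x \<delta>) y
        * ennreal (measure M (cball y (2 * \<delta>)) powr (q - 1)) \<partial>M)"
      using assms
      by (intro le_nn_integral_cball AE_I2 impI ennreal_leI powr_mono2 measure_cball_mono)
         (auto simp: cball_subset_cball_iff dist_commute)
    finally show "ennreal (measure M (cball x \<delta>) powr q)
      \<le> (\<integral>\<^sup>+y. indicator (cball x \<delta>) y * ennreal (measure M (cball y (2 * \<delta>)) powr (q - 1)) \<partial>M)" .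
  qed
  also have "\<dots> = ennreal (cball_volume TYPE('a) \<delta>)
      * (\<integral>\<^sup>+y. ennreal (measure M (cball y (2 * \<delta>)) powr (q - 1)) \<partial>M)"
    using assms by (intro nn_integral_ball_average sigma_finite_measure_axioms sets_M) auto
  finally show ?thesis .
qed

lemma le_ball_moment_of_one_le:
  assumes "1 \<le> q" "0 < \<delta>"
  shows "ennreal (cball_volume TYPE('a) \<delta>)
    * (\<integral>\<^sup>+y. ennreal (measure M (cball y \<delta>) powr (q - 1)) \<partial>M) \<le> ball_moment M q (2 * \<delta>)"
proof -
  have "ennreal (cball_volume TYPE('a) \<delta>) * (\<integral>\<^sup>+y. ennreal (measure M (cball y \<delta>) powr (q - 1)) \<partial>M)
      = (\<integral>\<^sup>+x. (\<integral>\<^sup>+y. indicator (cball x \<delta>) y * ennreal (measure M (cball y \<delta>) powr (q - 1)) \<partial>M) \<partial>lborel)"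
    using assms by (intro nn_integral_ball_average[symmetric] sigma_finite_measure_axioms sets_M) auto
  also have "\<dots> \<le> ball_moment M q (2 * \<delta>)"
    unfolding ball_moment_def
  proof (rule nn_integral_mono)
    fix x
    have "(\<integral>\<^sup>+y. indicator (cball x \<delta>) y * ennreal (measure M (cball y \<delta>) powr (q - 1)) \<partial>M)
        \<le> ennreal (measure M (cball x (2 * \<delta>)) powr (q - 1)) * ennreal (measure M (cball x \<delta>))"
      using assms
      by (intro nn_integral_cball_le ennreal_leI powr_mono2 measure_cball_mono)
         (auto simp: cball_subset_cball_iff dist_commute)
    also have "\<dots> \<le> ennreal (measure M (cball x (2 * \<delta>)) powr (q - 1)) * ennreal (measure M (cball x (2 * \<delta>)))"
      using assms by (intro mult_left_mono ennreal_leI measure_cball_mono) auto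
    also have "\<dots> = ennreal (measure M (cball x (2 * \<delta>)) powr q)"
      by (subst powr_eq_mult_powr_pred[of _ q]) (auto simp: ennreal_mult)
    finally show "(\<integral>\<^sup>+y. indicator (cball x \<delta>) y * ennreal (measure M (cball y \<delta>) powr (q - 1)) \<partial>M)
      \<le> ennreal (measure M (cball x (2 * \<delta>)) powr q)" .
  qed
  finally show ?thesis .
qed

text \<open>Since \<open>q - 1 \<le> 0\<close>, the integrand is bounded above by means of a larger
  ball around \<open>y\<close>: radius \<open>3 * \<delta>\<close> suffices to contain
  \<open>cball x (2 * \<delta>)\<close> for every \<open>y\<close> in
  \<open>cball x \<delta>\<close>.\<close>

lemma le_ball_moment_of_le_one:
  assumes "0 \<le> q" "q \<le> 1" "0 < \<delta>"
  shows "ennreal (cball_volume TYPE('a) \<delta>)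
    * (\<integral>\<^sup>+y. ennreal (measure M (cball y (3 * \<delta>)) powr (q - 1)) \<partial>M) \<le> ball_moment M q (2 * \<delta>)"
proof -
  have "ennreal (cball_volume TYPE('a) \<delta>) * (\<integral>\<^sup>+y. ennreal (measure M (cball y (3 * \<delta>)) powr (q - 1)) \<partial>M)
      = (\<integral>\<^sup>+x. (\<integral>\<^sup>+y. indicator (cball x \<delta>) y * ennreal (measure M (cball y (3 * \<delta>)) powr (q - 1)) \<partial>M) \<partial>lborel)"
    using assms by (intro nn_integral_ball_average[symmetric] sigma_finite_measure_axioms sets_M) auto
  also have "\<dots> \<le> ball_moment M q (2 * \<delta>)"
    unfolding ball_moment_def
  proof (rule nn_integral_mono)
    fix x
    show "(\<integral>\<^sup>+y. indicator (cball x \<delta>) y * ennreal (measure M (cball y (3 * \<delta>)) powr (q - 1)) \<partial>M)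
      \<le> ennreal (measure M (cball x (2 * \<delta>)) powr q)"
    \<comment> \<open>A nonpositive power is antitone only on positive bases. Over a null ball the
      integral vanishes because \<open>\<top> * 0 = 0\<close>.\<close>
    proof (cases "measure M (cball x \<delta>) = 0")
      case True
      have "(\<integral>\<^sup>+y. indicator (cball x \<delta>) y * ennreal (measure M (cball y (3 * \<delta>)) powr (q - 1)) \<partial>M)
          \<le> \<top> * ennreal (measure M (cball x \<delta>))"
        by (intro nn_integral_cball_le) auto
      then show ?thesis
        using True by simp
    next
      case False
      then have pos: "0 < measure M (cball x \<delta>)"
        by (simp add: less_le)
      moreover have le: "measure M (cball x \<delta>) \<le> measure M (cball x (2 * \<delta>))"
        using assms by (intro measure_cball_mono) auto
      ultimately have pos2: "0 < measure M (cball x (2 * \<delta>))"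
        by simp
      have "(\<integral>\<^sup>+y. indicator (cball x \<delta>) y * ennreal (measure M (cball y (3 * \<delta>)) powr (q - 1)) \<partial>M)
          \<le> ennreal (measure M (cball x (2 * \<delta>)) powr (q - 1)) * ennreal (measure M (cball x \<delta>))"
      proof (intro nn_integral_cball_le ennreal_leI powr_mono2')
        fix y assume "y \<in> cball x \<delta>"
        then have "cball x (2 * \<delta>) \<subseteq> cball y (3 * \<delta>)"
          by (simp add: cball_subset_cball_iff dist_commute)
        then show "measure M (cball x (2 * \<delta>)) \<le> measure M (cball y (3 * \<delta>))"
          by (rule measure_cball_mono)
      qed (use assms pos2 in auto)
      also have "\<dots> \<le> ennreal (measure M (cball x (2 * \<delta>)) powr (q - 1)) * ennreal (measure M (cball x (2 * \<delta>)))"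
        using le by (intro mult_left_mono ennreal_leI) auto
      also have "\<dots> = ennreal (measure M (cball x (2 * \<delta>)) powr q)"
        by (subst powr_eq_mult_powr_pred[of _ q]) (auto simp: ennreal_mult)
      finally show ?thesis .
    qed
  qed
  finally show ?thesis .
qed

text \<open>
  Since the mass of a ball is at most 1 and that of the ball of radius \<open>2 * \<delta>\<close> is at least
  \<open>1 / 2 ^ n\<close>, the mass cannot double at each of the radii \<open>2 * \<delta>, 3 * \<delta>, \<dots>, (n + 2) * \<delta>\<close>.
\<close>
lemma obtain_nondoubling_radius:
  assumes "1 \<le> 2 ^ n * measure M (cball x (2 * \<delta>))"
  obtains k where "k \<le> n"
    "measure M (cball x (real (k + 3) * \<delta>)) \<le> 2 * measure M (cball x (real (k + 2) * \<delta>))"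
proof -
  define f where "f k = measure M (cball x (real (k + 2) * \<delta>))" for k
  have f0: "1 \<le> 2 ^ n * f 0"
    using assms by (simp add: f_def)
  have "\<exists>k\<le>n. f (Suc k) \<le> 2 * f k"
  proof (rule ccontr)
    assume "\<not> (\<exists>k\<le>n. f (Suc k) \<le> 2 * f k)"
    then have step: "2 * f k < f (Suc k)" if "k \<le> n" for k
      using that by (meson linorder_not_le)
    have "2 ^ k * f 0 \<le> f k" if "k \<le> Suc n" for k
      using that
    proof (induction k)
      case (Suc k)
      then have "2 ^ k * f 0 \<le> f k" "2 * f k < f (Suc k)"
        using step by auto
      then show ?case
        by simp
    qed simp
    then have "2 ^ n * f 0 \<le> f n" "2 * f n < f (Suc n)"
      using step by auto
    moreover have "f (Suc n) \<le> 1"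
      by (simp add: f_def)
    ultimately show False
      using f0 by simp
  qed
  then show ?thesis
    using that by (auto simp: f_def add.commute numeral_3_eq_3)
qed

text \<open>At a nondoubling radius the masses \<open>a\<close> and \<open>b\<close> of two
  consecutive balls around \<open>x\<close> differ by at most a factor 2, so
  \<open>a powr (q - 1) \<le> 2 * b powr (q - 1)\<close>. Every \<open>y\<close> in the inner ball
  has \<open>cball y \<delta>\<close> inside the outer one, hence
  \<open>b powr (q - 1) \<le> h y\<close> almost everywhere; integrating over the inner ball bounds
  \<open>a powr q\<close>.\<close>

lemma ball_moment_le_of_le_one:
  assumes q: "0 \<le> q" "q \<le> 1" and \<delta>: "0 < \<delta>"
    and n: "\<And>x. 0 < measure M (cball x \<delta>) \<Longrightarrow> 1 \<le> 2 ^ n * measure M (cball x (2 * \<delta>))"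
  shows "ball_moment M q \<delta> \<le> ennreal (2 * cball_volume TYPE('a) (real (n + 2) * \<delta>))
    * (\<integral>\<^sup>+y. ennreal (measure M (cball y \<delta>) powr (q - 1)) \<partial>M)"
proof -
  define h where "h y = ennreal (measure M (cball y \<delta>) powr (q - 1))" for y
  have [measurable]: "h \<in> borel_measurable borel"
    unfolding h_def by measurable
  have "ball_moment M q \<delta> \<le> (\<integral>\<^sup>+x. (\<integral>\<^sup>+y. indicator (cball x (real (n + 2) * \<delta>)) y * (2 * h y) \<partial>M) \<partial>lborel)"
    unfolding ball_moment_def
  proof (rule nn_integral_mono)
    fix x
    show "ennreal (measure M (cball x \<delta>) powr q)
      \<le> (\<integral>\<^sup>+y. indicator (cball x (real (n + 2) * \<delta>)) y * (2 * h y) \<partial>M)"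
    proof (cases "measure M (cball x \<delta>) = 0")
      case False
      then have pos: "0 < measure M (cball x \<delta>)"
        by (simp add: less_le)
      obtain k where k: "k \<le> n"
        "measure M (cball x (real (k + 3) * \<delta>)) \<le> 2 * measure M (cball x (real (k + 2) * \<delta>))"
        using obtain_nondoubling_radius[OF n[OF pos]] .
      define a b where "a = measure M (cball x (real (k + 2) * \<delta>))"
        and "b = measure M (cball x (real (k + 3) * \<delta>))"
      have "measure M (cball x \<delta>) \<le> a"
        unfolding a_def using \<delta> by (intro measure_cball_mono) (auto simp: cball_subset_cball_iff algebra_simps)
      then have a: "0 < a"
        using pos by simp
      have "a \<le> b"
        unfolding a_def b_def using \<delta> by (intro measure_cball_mono) (auto simp: cball_subset_cball_iff algebra_simps)
      then have b: "0 < b"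
        using a by simp
      have "a powr (q - 1) \<le> (b / 2) powr (q - 1)"
        using k b q by (intro powr_mono2') (auto simp: a_def b_def)
      also have "\<dots> = 2 powr (1 - q) * b powr (q - 1)"
        using b by (simp add: powr_divide powr_diff)
      also have "\<dots> \<le> 2 * b powr (q - 1)"
        using q powr_mono[of "1 - q" 1 "2::real"] by (intro mult_right_mono) auto
      finally have "a powr (q - 1) * a \<le> (2 * b powr (q - 1)) * a"
        using a by (intro mult_right_mono) auto
      moreover have "measure M (cball x \<delta>) powr q \<le> a powr (q - 1) * a"
        using q \<open>_ \<le> a\<close> a by (subst powr_eq_mult_powr_pred[symmetric]) (auto intro: powr_mono2)
      ultimately have "measure M (cball x \<delta>) powr q \<le> 2 * b powr (q - 1) * a"
        by linarith
      then have "ennreal (measure M (cball x \<delta>) powr q) \<le> ennreal (2 * b powr (q - 1)) * ennreal a"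
        using a b by (subst ennreal_mult[symmetric]) (auto intro: ennreal_leI)
      also have "\<dots> \<le> (\<integral>\<^sup>+y. indicator (cball x (real (k + 2) * \<delta>)) y * (2 * h y) \<partial>M)"
        unfolding a_def
      proof (rule le_nn_integral_cball)
        \<comment> \<open>Only almost every \<open>y\<close> will do: at a \<open>y\<close> with
          null ball and \<open>q < 1\<close> the value \<open>0 powr (q - 1) = 0\<close> is too
          small.\<close>
        show "AE y in M. y \<in> cball x (real (k + 2) * \<delta>) \<longrightarrow> ennreal (2 * b powr (q - 1)) \<le> 2 * h y"
          using AE_measure_cball_pos[OF \<delta>]
        proof eventually_elim
          case (elim y)
          show ?case
          proof
            assume "y \<in> cball x (real (k + 2) * \<delta>)"
            then have "cball y \<delta> \<subseteq> cball x (real (k + 3) * \<delta>)"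
              by (simp add: cball_subset_cball_iff dist_commute algebra_simps)
            then have "measure M (cball y \<delta>) \<le> b"
              unfolding b_def by (rule measure_cball_mono)
            then have "b powr (q - 1) \<le> measure M (cball y \<delta>) powr (q - 1)"
              using elim q by (intro powr_mono2') auto
            then show "ennreal (2 * b powr (q - 1)) \<le> 2 * h y"
              by (simp add: h_def ennreal_mult' mult_left_mono)
          qed
        qed
      qed
      \<comment> \<open>The radius so far depends on \<open>x\<close> through \<open>k\<close>;
        averaging over \<open>x\<close> needs a common one.\<close>
      also have "\<dots> \<le> (\<integral>\<^sup>+y. indicator (cball x (real (n + 2) * \<delta>)) y * (2 * h y) \<partial>M)"
      proof -
        have "real (k + 2) * \<delta> \<le> real (n + 2) * \<delta>"
          using \<delta> k by (intro mult_right_mono) auto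
        then have "cball x (real (k + 2) * \<delta>) \<subseteq> cball x (real (n + 2) * \<delta>)"
          by (rule subset_cball)
        then show ?thesis
          by (intro nn_integral_mono mult_right_mono) (auto simp: indicator_def)
      qed
      finally show ?thesis .
    qed simp
  qed
  also have "\<dots> = ennreal (cball_volume TYPE('a) (real (n + 2) * \<delta>)) * (\<integral>\<^sup>+y. 2 * h y \<partial>M)"
    using \<delta> by (intro nn_integral_ball_average sigma_finite_measure_axioms sets_M) auto
  also have "\<dots> = ennreal (2 * cball_volume TYPE('a) (real (n + 2) * \<delta>)) * (\<integral>\<^sup>+y. h y \<partial>M)"
    by (subst nn_integral_cmult) (auto simp: ennreal_mult' mult_ac)
  finally show ?thesis
    by (simp add: h_def)
qed

end

section \<open>Growth exponents\<close>

text \<open>Fekete's lemma for a real argument: write \<open>t = k * s + u\<close> with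
  \<open>u\<close> in \<open>{0..s}\<close>, where the local upper bound controls
  \<open>f u\<close>. The infimum may be \<open>-\<infinity>\<close>.\<close>

lemma fekete_tendsto_Inf:
  fixes f :: "real \<Rightarrow> real"
  assumes sub: "\<And>s t. 0 \<le> s \<Longrightarrow> 0 \<le> t \<Longrightarrow> f (s + t) \<le> f s + f t"
    and bdd: "\<And>s. 0 < s \<Longrightarrow> \<exists>B. \<forall>t\<in>{0..s}. f t \<le> B"
  shows "((\<lambda>t. ereal (f t / t)) \<longlongrightarrow> (INF s\<in>{0<..}. ereal (f s / s))) at_top"
proof (rule order_tendstoI)
  fix a assume a: "a < (INF s\<in>{0<..}. ereal (f s / s))"
  show "\<forall>\<^sub>F t in at_top. a < ereal (f t / t)"
    using eventually_gt_at_top[of 0]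
  proof eventually_elim
    case (elim t)
    then have "(INF s\<in>{0<..}. ereal (f s / s)) \<le> ereal (f t / t)"
      by (intro INF_lower) auto
    then show ?case
      using a by simp
  qed
next
  fix a assume "(INF s\<in>{0<..}. ereal (f s / s)) < a"
  then obtain s where s: "0 < s" "ereal (f s / s) < a"
    by (auto simp: INF_less_iff)
  then obtain a' where a': "f s / s < a'" "ereal a' < a"
    by (metis ereal_dense2 less_ereal.simps(1))
  obtain B where B: "\<And>t. t \<in> {0..s} \<Longrightarrow> f t \<le> B"
    using bdd[OF s(1)] by blast
  \<comment> \<open>The first term pays for replacing \<open>k\<close> by \<open>t / s\<close>,
    which differ by at most 1, and the second for the remainder \<open>f u\<close>.\<close>
  define D where "D = \<bar>f s\<bar> + \<bar>B\<bar>"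
  have bound: "f t / t \<le> f s / s + D / t" if "0 < t" for t
  proof -
    define k where "k = nat \<lfloor>t / s\<rfloor>"
    have k: "real k \<le> t / s" "t / s < real k + 1"
      using that s by (auto simp: k_def)
    define u where "u = t - real k * s"
    have u: "u \<in> {0..s}"
      using k s by (auto simp: u_def field_simps)
    have step: "f (real j * s + u) \<le> real j * f s + f u" for j
    proof (induction j)
      case (Suc j)
      have "f (real (Suc j) * s + u) = f (s + (real j * s + u))"
        by (simp add: algebra_simps)
      also have "\<dots> \<le> f s + f (real j * s + u)"
        using s u by (intro sub) auto
      finally show ?case
        using Suc by (simp add: algebra_simps)
    qed simp
    have "f t \<le> real k * f s + f u"
      using step[of k] by (simp add: u_def)
    also have "\<dots> \<le> t / s * f s + D"
    proof -
      have "real k * f s - t / s * f s = (real k - t / s) * f s"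
        by (simp add: algebra_simps)
      also have "\<dots> \<le> \<bar>real k - t / s\<bar> * \<bar>f s\<bar>"
        by (metis abs_ge_self abs_mult)
      also have "\<dots> \<le> 1 * \<bar>f s\<bar>"
        using k by (intro mult_right_mono) auto
      finally show ?thesis
        using B[OF u] by (simp add: D_def)
    qed
    finally have "f t / t \<le> (t / s * f s + D) / t"
      using that by (intro divide_right_mono) auto
    also have "\<dots> = f s / s + D / t"
      using that s by (simp add: field_simps)
    finally show ?thesis .
  qed
  have "((\<lambda>t. f s / s + D / t) \<longlongrightarrow> f s / s + 0) at_top"
    by (intro tendsto_intros real_tendsto_divide_at_top[OF tendsto_const filterlim_ident])
  then have "\<forall>\<^sub>F t in at_top. f s / s + D / t < a'"
    using a'(1) by (auto dest: order_tendstoD(2))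
  then show "\<forall>\<^sub>F t in at_top. ereal (f t / t) < a"
    using eventually_gt_at_top[of 0]
  proof eventually_elim
    case (elim t)
    then have "f t / t < a'"
      using bound[of t] by simp
    then show ?case
      using a'(2) by (metis less_ereal.simps(1) less_trans)
  qed
qed

lemma tendsto_exp_neg_imp_tendsto_at_right_0:
  fixes F :: "real \<Rightarrow> ereal"
  assumes "((\<lambda>t. F (exp (- t))) \<longlongrightarrow> L) at_top"
  shows "(F \<longlongrightarrow> L) (at_right 0)"
proof -
  have "filterlim (\<lambda>\<delta>::real. - ln \<delta>) at_top (at_right 0)"
    by real_asymp
  then have "((\<lambda>\<delta>. F (exp (- (- ln \<delta>)))) \<longlongrightarrow> L) (at_right 0)"
    by (rule filterlim_compose[OF assms])
  moreover have "\<forall>\<^sub>F \<delta> in at_right 0. F (exp (- (- ln \<delta>))) = F \<delta>"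
    using eventually_at_right_less[of "0::real"] by eventually_elim simp
  ultimately show ?thesis
    using filterlim_cong[OF refl refl] by fast
qed

text \<open>The limit of the perturbation is finite, so addition is continuous there even if
  \<open>L\<close> is infinite.\<close>

lemma tendsto_ereal_perturb:
  fixes a b :: "real \<Rightarrow> real"
  assumes "((\<lambda>\<delta>. ereal (a \<delta>)) \<longlongrightarrow> L) F" "((\<lambda>\<delta>. b \<delta> - a \<delta>) \<longlongrightarrow> c) F"
  shows "((\<lambda>\<delta>. ereal (b \<delta>)) \<longlongrightarrow> L + ereal c) F"
proof -
  have "((\<lambda>\<delta>. ereal (a \<delta>) + ereal (b \<delta> - a \<delta>)) \<longlongrightarrow> L + ereal c) F"
    using assms by (intro tendsto_add_ereal_general1) auto
  then show ?thesis
    by simp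
qed

text \<open>In the variable \<open>t = - ln \<delta>\<close> the factor \<open>k\<close> becomes the
  additive constant \<open>ln k\<close>. Including it in \<open>f\<close> makes \<open>f\<close>
  exactly subadditive, and \<open>ln k / t\<close> disappears in the limit. Monotonicity of
  \<open>g\<close> bounds \<open>f\<close> by \<open>f 0\<close>.\<close>

lemma submultiplicative_exponent:
  fixes g :: "real \<Rightarrow> real"
  assumes pos: "\<And>\<delta>. 0 < \<delta> \<Longrightarrow> 0 < g \<delta>"
    and mono: "\<And>\<delta> \<delta>'. 0 < \<delta> \<Longrightarrow> \<delta> \<le> \<delta>' \<Longrightarrow> g \<delta> \<le> g \<delta>'"
    and k: "0 < k" and "\<And>r \<epsilon>. 0 < r \<Longrightarrow> r \<le> 1 \<Longrightarrow> 0 < \<epsilon> \<Longrightarrow> \<epsilon> \<le> 1 \<Longrightarrow> g (r * \<epsilon>) \<le> k * (g r * g \<epsilon>)"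
  shows "\<exists>L. ((\<lambda>\<delta>. ereal (ln (g \<delta>) / (- ln \<delta>))) \<longlongrightarrow> L) (at_right 0)"
proof -
  define f where "f t = ln (g (exp (- t))) + ln k" for t
  have "f (s + t) \<le> f s + f t" if "0 \<le> s" "0 \<le> t" for s t
  proof -
    have "g (exp (- (s + t))) \<le> k * (g (exp (- s)) * g (exp (- t)))"
      using assms(4)[of "exp (- s)" "exp (- t)"] that by (simp add: exp_add[symmetric])
    then have "ln (g (exp (- (s + t)))) \<le> ln (k * (g (exp (- s)) * g (exp (- t))))"
      using pos k by (subst ln_le_cancel_iff) auto
    also have "\<dots> = ln k + (ln (g (exp (- s))) + ln (g (exp (- t))))"
      using pos k by (simp add: ln_mult_pos)
    finally show ?thesis
      by (simp add: f_def)
  qed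
  moreover have "\<exists>B. \<forall>t\<in>{0..s}. f t \<le> B" for s
  proof (intro exI[of _ "f 0"] ballI)
    fix t assume "t \<in> {0..s}"
    then have "g (exp (- t)) \<le> g (exp (- 0))"
      by (intro mono) auto
    then show "f t \<le> f 0"
      using pos by (auto simp: f_def intro!: ln_mono)
  qed
  ultimately obtain L where "((\<lambda>t. ereal (f t / t)) \<longlongrightarrow> L) at_top"
    using fekete_tendsto_Inf[of f] by blast
  moreover have "((\<lambda>t. ln (g (exp (- t))) / t - f t / t) \<longlongrightarrow> 0) at_top"
  proof -
    have "((\<lambda>t. - ln k / t) \<longlongrightarrow> 0) at_top"
      by real_asymp
    also have "(\<lambda>t. - ln k / t) = (\<lambda>t. ln (g (exp (- t))) / t - f t / t)"
      by (simp add: f_def fun_eq_iff add_divide_distrib)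
    finally show ?thesis .
  qed
  ultimately have "((\<lambda>t. ereal (ln (g (exp (- t))) / t)) \<longlongrightarrow> L + ereal 0) at_top"
    by (rule tendsto_ereal_perturb)
  then show ?thesis
    by (intro exI[of _ "L + ereal 0"] tendsto_exp_neg_imp_tendsto_at_right_0) simp
qed

text \<open>Fekete's lemma is applied to the negative of the logarithm. The sign change makes
  \<open>f\<close> increasing, so its bound on \<open>{0..s}\<close> is now attained at the end
  \<open>s\<close>.\<close>

lemma supermultiplicative_exponent:
  fixes g :: "real \<Rightarrow> real"
  assumes pos: "\<And>\<delta>. 0 < \<delta> \<Longrightarrow> 0 < g \<delta>"
    and mono: "\<And>\<delta> \<delta>'. 0 < \<delta> \<Longrightarrow> \<delta> \<le> \<delta>' \<Longrightarrow> g \<delta> \<le> g \<delta>'"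
    and k: "0 < k" and "\<And>r \<epsilon>. 0 < r \<Longrightarrow> r \<le> 1 \<Longrightarrow> 0 < \<epsilon> \<Longrightarrow> \<epsilon> \<le> 1 \<Longrightarrow> k * (g r * g \<epsilon>) \<le> g (r * \<epsilon>)"
  shows "\<exists>L. ((\<lambda>\<delta>. ereal (ln (g \<delta>) / (- ln \<delta>))) \<longlongrightarrow> L) (at_right 0)"
proof -
  define f where "f t = - ln (g (exp (- t))) - ln k" for t
  have "f (s + t) \<le> f s + f t" if "0 \<le> s" "0 \<le> t" for s t
  proof -
    have "k * (g (exp (- s)) * g (exp (- t))) \<le> g (exp (- (s + t)))"
      using assms(4)[of "exp (- s)" "exp (- t)"] that by (simp add: exp_add[symmetric])
    then have "ln (k * (g (exp (- s)) * g (exp (- t)))) \<le> ln (g (exp (- (s + t))))"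
      using pos k by (subst ln_le_cancel_iff) auto
    moreover have "ln (k * (g (exp (- s)) * g (exp (- t)))) = ln k + (ln (g (exp (- s))) + ln (g (exp (- t))))"
      using pos k by (simp add: ln_mult_pos)
    ultimately show ?thesis
      by (simp add: f_def)
  qed
  moreover have "\<exists>B. \<forall>t\<in>{0..s}. f t \<le> B" for s
  proof (intro exI[of _ "f s"] ballI)
    fix t assume "t \<in> {0..s}"
    then have "g (exp (- s)) \<le> g (exp (- t))"
      by (intro mono) auto
    then show "f t \<le> f s"
      using pos by (auto simp: f_def intro!: ln_mono)
  qed
  ultimately obtain L where "((\<lambda>t. ereal (f t / t)) \<longlongrightarrow> L) at_top"
    using fekete_tendsto_Inf[of f] by blast
  then have "((\<lambda>t. - ereal (f t / t)) \<longlongrightarrow> - L) at_top"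
    by (rule tendsto_uminus_ereal)
  then have "((\<lambda>t. ereal (- (f t / t))) \<longlongrightarrow> - L) at_top"
    by simp
  moreover have "((\<lambda>t. ln (g (exp (- t))) / t - (- (f t / t))) \<longlongrightarrow> 0) at_top"
  proof -
    have "((\<lambda>t. - ln k / t) \<longlongrightarrow> 0) at_top"
      by real_asymp
    also have "(\<lambda>t. - ln k / t) = (\<lambda>t. ln (g (exp (- t))) / t - (- (f t / t)))"
      by (simp add: f_def fun_eq_iff diff_divide_distrib)
    finally show ?thesis .
  qed
  ultimately have "((\<lambda>t. ereal (ln (g (exp (- t))) / t)) \<longlongrightarrow> - L + ereal 0) at_top"
    by (rule tendsto_ereal_perturb)
  then show ?thesis
    by (intro exI[of _ "- L + ereal 0"] tendsto_exp_neg_imp_tendsto_at_right_0) simp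
qed

text \<open>After taking logarithms the total error is at most
  \<open>\<bar>ln A\<bar> + D * ln (1 - ln \<delta>)\<close>, which is of smaller order than
  \<open>- ln \<delta>\<close>. The factor \<open>\<delta> ^ D\<close> accounts for the shift by
  \<open>D\<close>.\<close>

lemma exponent_shift:
  fixes g h :: "real \<Rightarrow> real"
  assumes A: "0 < A" and gh: "\<And>\<delta>. 0 < \<delta> \<Longrightarrow> \<delta> < 1 \<Longrightarrow> 0 < g \<delta>"
    "\<And>\<delta>. 0 < \<delta> \<Longrightarrow> \<delta> < 1 \<Longrightarrow> \<delta> ^ D * h \<delta> \<le> A * g \<delta>"
    "\<And>\<delta>. 0 < \<delta> \<Longrightarrow> \<delta> < 1 \<Longrightarrow> g \<delta> \<le> A * (1 - ln \<delta>) ^ D * (\<delta> ^ D * h \<delta>)"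
    and L: "((\<lambda>\<delta>. ereal (ln (g \<delta>) / (- ln \<delta>))) \<longlongrightarrow> L) (at_right 0)"
  shows "((\<lambda>\<delta>. ereal (ln (h \<delta>) / (- ln \<delta>))) \<longlongrightarrow> L + ereal (real D)) (at_right 0)"
  using L
proof (rule tendsto_ereal_perturb)
  define E where "E \<delta> = (\<bar>ln A\<bar> + real D * ln (1 - ln \<delta>)) / (- ln \<delta>)" for \<delta> :: real
  have bound: "norm (ln (h \<delta>) / (- ln \<delta>) - ln (g \<delta>) / (- ln \<delta>) - real D) \<le> E \<delta>"
    if \<delta>: "0 < \<delta>" "\<delta> < 1" for \<delta>
  proof -
    have ln_neg: "ln \<delta> < 0"
      using \<delta> by simp
    have g: "0 < g \<delta>"
      using gh(1) \<delta> .
    \<comment> \<open>Positivity of \<open>h \<delta>\<close>, required for its logarithm, is forced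
      by the upper bound on the positive number \<open>g \<delta>\<close>.\<close>
    have "0 < (A * (1 - ln \<delta>) ^ D * \<delta> ^ D) * h \<delta>"
      using gh(3)[OF \<delta>] g by (simp add: mult.assoc)
    moreover have "0 < 1 - ln \<delta>"
      using ln_neg by linarith
    then have "0 < A * (1 - ln \<delta>) ^ D * \<delta> ^ D"
      using A \<delta>(1) by (intro mult_pos_pos zero_less_power)
    ultimately have h: "0 < h \<delta>"
      by (rule zero_less_mult_pos)
    define e where "e = ln (h \<delta>) + real D * ln \<delta> - ln (g \<delta>)"
    have "ln (\<delta> ^ D * h \<delta>) \<le> ln (A * g \<delta>)"
      using gh(2)[OF \<delta>] A g h \<delta> by (subst ln_le_cancel_iff) auto
    then have "e \<le> ln A"
      using A g h \<delta> by (simp add: ln_mult_pos ln_realpow e_def)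
    moreover have "ln (g \<delta>) \<le> ln (A * (1 - ln \<delta>) ^ D * (\<delta> ^ D * h \<delta>))"
      using gh(3)[OF \<delta>] A g h \<delta> ln_neg by (subst ln_le_cancel_iff) auto
    then have "- e \<le> ln A + real D * ln (1 - ln \<delta>)"
      using A g h \<delta> ln_neg by (simp add: ln_mult_pos ln_realpow e_def)
    moreover have "0 \<le> real D * ln (1 - ln \<delta>)"
      using ln_neg by (intro mult_nonneg_nonneg ln_ge_zero) auto
    ultimately have "\<bar>e\<bar> \<le> \<bar>ln A\<bar> + real D * ln (1 - ln \<delta>)"
      by linarith
    then have "\<bar>e\<bar> / (- ln \<delta>) \<le> E \<delta>"
      unfolding E_def using ln_neg by (intro divide_right_mono) auto
    moreover have "ln (h \<delta>) / (- ln \<delta>) - ln (g \<delta>) / (- ln \<delta>) - real D = e / (- ln \<delta>)"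
      using ln_neg by (simp add: e_def field_simps)
    moreover have "norm (e / (- ln \<delta>)) = \<bar>e\<bar> / (- ln \<delta>)"
      using ln_neg by simp
    ultimately show ?thesis
      by (simp only:)
  qed
  have "(E \<longlongrightarrow> 0) (at_right 0)"
    unfolding E_def by real_asymp
  moreover have "\<forall>\<^sub>F \<delta> in at_right 0. norm (ln (h \<delta>) / (- ln \<delta>) - ln (g \<delta>) / (- ln \<delta>) - real D) \<le> E \<delta>"
  proof -
    have "\<forall>\<^sub>F \<delta> in at_right 0. \<delta> \<in> {0<..<1::real}"
      by (rule eventually_at_right_real) simp
    then show ?thesis
    proof eventually_elim
      case (elim \<delta>)
      then show ?case
        by (intro bound) auto
    qed
  qed
  ultimately have "((\<lambda>\<delta>. ln (h \<delta>) / (- ln \<delta>) - ln (g \<delta>) / (- ln \<delta>) - real D) \<longlongrightarrow> 0) (at_right 0)"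
    by (rule Lim_null_comparison[rotated])
  then show "((\<lambda>\<delta>. ln (h \<delta>) / (- ln \<delta>) - ln (g \<delta>) / (- ln \<delta>)) \<longlongrightarrow> real D) (at_right 0)"
    by (rule LIM_zero_cancel)
qed

section \<open>Graph-directed self-similar measures\<close>

locale graph_directed_measures = graph_directed_ifs G N S c p
  for G :: "(nat, 'e) pre_digraph" and N and S :: "'e \<Rightarrow> real ^ 'd \<Rightarrow> real ^ 'd" and c p +
  fixes \<mu> :: "nat \<Rightarrow> (real ^ 'd) measure"
  assumes self_similar_measures: "graph_directed_self_similar_measures G N S p \<mu>"
begin

lemma sum_arcs_from_to:
  assumes "i \<in> verts G"
  shows "(\<Sum>j = 1..N. \<Sum>e\<in>arcs_from_to G i j. g e j) = (\<Sum>e\<in>out_arcs G i. g e (head G e))"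
proof -
  have "(\<Sum>e\<in>out_arcs G i. g e (head G e))
      = (\<Sum>j\<in>{1..N}. \<Sum>e\<in>{e \<in> out_arcs G i. head G e = j}. g e (head G e))"
  proof (rule sum.group[symmetric])
    show "head G ` out_arcs G i \<subseteq> {1..N}"
      using head_in_verts verts_eq by (auto simp: out_arcs_def)
  qed (auto simp: out_arcs_def)
  also have "\<dots> = (\<Sum>j = 1..N. \<Sum>e\<in>arcs_from_to G i j. g e j)"
    by (intro sum.cong) (auto simp: arcs_from_to_def out_arcs_def)
  finally show ?thesis ..
qed

lemma sum_p_out_arcs: "i \<in> verts G \<Longrightarrow> (\<Sum>e\<in>out_arcs G i. p e) = 1"
  using prob_sum[of i] sum_arcs_from_to[of i "\<lambda>e _. p e"] by simp

lemma borel_prob_space_\<mu>: "i \<in> verts G \<Longrightarrow> borel_prob_space (\<mu> i)"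
  using self_similar_measures
  unfolding graph_directed_self_similar_measures_def borel_prob_space_def borel_prob_space_axioms_def
  by blast

lemma measure_self_similar:
  assumes "i \<in> verts G" "A \<in> sets borel"
  shows "measure (\<mu> i) A = (\<Sum>e\<in>out_arcs G i. p e * measure (\<mu> (head G e)) (S e -` A))"
  using self_similar_measures assms
    sum_arcs_from_to[OF assms(1), of "\<lambda>e j. p e * measure (\<mu> j) (S e -` A)"]
  unfolding graph_directed_self_similar_measures_def by simp

section \<open>Uniform constants and a ball that carries all the measures\<close>

definition c_min :: real where "c_min = Min (insert (1/2) (c ` arcs G))"
definition c_max :: real where "c_max = Max (insert (1/2) (c ` arcs G))"
definition p_min :: real where "p_min = Min (insert (1/2) (p ` arcs G))"

text \<open>The inserted \<open>1/2\<close> makes every set visibly non-empty, and it leaves the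
  extreme ratios strictly between 0 and 1.\<close>

lemma c_min_pos: "0 < c_min" and c_min_less_one: "c_min < 1"
  and c_max_pos: "0 < c_max" and c_max_less_one: "c_max < 1"
  and p_min_pos: "0 < p_min"
  using ratio prob
  by (auto simp: c_min_def c_max_def p_min_def Min_gr_iff Min_less_iff Max_less_iff Max_gr_iff
      simp del: Min_insert Max_insert)

lemma c_min_le: "e \<in> arcs G \<Longrightarrow> c_min \<le> c e"
  and c_le_c_max: "e \<in> arcs G \<Longrightarrow> c e \<le> c_max"
  and p_min_le: "e \<in> arcs G \<Longrightarrow> p_min \<le> p e"
  by (auto simp: c_min_def c_max_def p_min_def simp del: Min_insert Max_insert intro: Min_le Max_ge)

lemma S_vimage_measurable:
  "e \<in> arcs G \<Longrightarrow> A \<in> sets borel \<Longrightarrow> S e -` A \<in> sets borel"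
  using measurable_sets[OF similarity_map_measurable[OF similarity] ] ratio by force

definition origin_shift :: real where
  "origin_shift = Max (insert 0 ((\<lambda>e. norm (S e 0)) ` arcs G))"

text \<open>The quotient is the fixed point of
  \<open>\<rho> \<mapsto> origin_shift + c_max * \<rho>\<close>, so from this radius on each
  \<open>S e\<close> maps the ball around 0 into itself. The added 1 leaves room to reach the radius
  from outside by geometric steps.\<close>

definition attractor_radius :: real where
  "attractor_radius = origin_shift / (1 - c_max) + 1"

lemma norm_S_0_le: "e \<in> arcs G \<Longrightarrow> norm (S e 0) \<le> origin_shift"
  and origin_shift_nonneg: "0 \<le> origin_shift"
  by (auto simp: origin_shift_def simp del: Max_insert intro: Max_ge)

lemma attractor_radius_ge_one: "1 \<le> attractor_radius"
  using origin_shift_nonneg c_max_less_one by (simp add: attractor_radius_def)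

lemma cball_subset_S_vimage:
  assumes e: "e \<in> arcs G" and "0 \<le> \<rho>"
  shows "cball 0 \<rho> \<subseteq> S e -` cball 0 (origin_shift + c_max * \<rho>)"
proof
  fix x assume x: "x \<in> cball (0 :: real ^ 'd) \<rho>"
  have "norm (S e x) \<le> norm (S e 0) + dist (S e x) (S e 0)"
    by (simp add: dist_norm norm_triangle_sub)
  also have "dist (S e x) (S e 0) = c e * norm x"
    using similarity[OF e] by (simp add: similarity_map_def)
  also have "\<dots> \<le> c_max * \<rho>"
    using x c_le_c_max[OF e] ratio[OF e] c_max_pos by (intro mult_mono) auto
  finally show "x \<in> S e -` cball 0 (origin_shift + c_max * \<rho>)"
    using norm_S_0_le[OF e] by simp
qed

text \<open>Self-similarity carries a lower bound on the masses, valid at all vertices, from one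
  ball to the next smaller one. Large balls have masses close to 1 at all of the finitely many
  vertices, so every bound \<open>t < 1\<close> descends to the smallest ball.\<close>

lemma measure_attractor_ball:
  assumes i: "i \<in> verts G"
  shows "measure (\<mu> i) (cball 0 attractor_radius) = 1"
proof -
  define R0 where "R0 = origin_shift / (1 - c_max)"
  \<comment> \<open>Chosen so that each \<open>S e\<close> maps the ball of radius
    \<open>\<rho> (Suc n)\<close> into the one of radius \<open>\<rho> n\<close>, with
    \<open>\<rho> 0 = attractor_radius\<close>.\<close>
  define \<rho> where "\<rho> n = R0 + (1 / c_max) ^ n" for n :: nat
  have R0: "0 \<le> R0"
    using origin_shift_nonneg c_max_less_one by (simp add: R0_def)
  have \<rho>_nonneg: "0 \<le> \<rho> n" for n
    using R0 c_max_pos by (simp add: \<rho>_def)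
  have R0_fix: "origin_shift + c_max * R0 = R0"
    using c_max_less_one by (simp add: R0_def field_simps)
  have \<rho>_Suc: "origin_shift + c_max * \<rho> (Suc n) = \<rho> n" for n
    using R0_fix c_max_pos by (simp add: \<rho>_def algebra_simps)
  have descend: "\<forall>j\<in>verts G. t \<le> measure (\<mu> j) (cball 0 (\<rho> 0))"
    if "\<forall>j\<in>verts G. t \<le> measure (\<mu> j) (cball 0 (\<rho> n))" for n t
    using that
  proof (induction n)
    case (Suc n)
    have "t \<le> measure (\<mu> j) (cball 0 (\<rho> n))" if j: "j \<in> verts G" for j
    proof -
      have "t = (\<Sum>e\<in>out_arcs G j. p e * t)"
        using sum_p_out_arcs[OF j] by (simp flip: sum_distrib_right)
      also have "\<dots> \<le> (\<Sum>e\<in>out_arcs G j. p e * measure (\<mu> (head G e)) (S e -` cball 0 (\<rho> n)))"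
      proof (rule sum_mono)
        fix e assume "e \<in> out_arcs G j"
        then have e: "e \<in> arcs G"
          by simp
        interpret borel_prob_space "\<mu> (head G e)"
          using e by (intro borel_prob_space_\<mu>) simp
        have "t \<le> measure (\<mu> (head G e)) (cball 0 (\<rho> (Suc n)))"
          using Suc.prems e by simp
        also have "\<dots> \<le> measure (\<mu> (head G e)) (S e -` cball 0 (\<rho> n))"
          using cball_subset_S_vimage[OF e \<rho>_nonneg[of "Suc n"]] \<rho>_Suc[of n] S_vimage_measurable[OF e]
          by (intro finite_measure_mono) (auto simp: sets_M)
        finally show "p e * t \<le> p e * measure (\<mu> (head G e)) (S e -` cball 0 (\<rho> n))"
          using prob[OF e] by (intro mult_left_mono) auto
      qed
      also have "\<dots> = measure (\<mu> j) (cball 0 (\<rho> n))"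
        using j by (intro measure_self_similar[symmetric]) auto
      finally show ?thesis .
    qed
    then show ?case
      using Suc.IH by blast
  qed
  have lim: "(\<lambda>n. measure (\<mu> j) (cball 0 (\<rho> n))) \<longlonglongrightarrow> 1" if j: "j \<in> verts G" for j
  proof -
    interpret borel_prob_space "\<mu> j"
      using j by (rule borel_prob_space_\<mu>)
    have one_less: "1 < 1 / c_max"
      using c_max_pos c_max_less_one by simp
    then have "incseq (\<lambda>n. cball (0 :: real ^ 'd) (\<rho> n))"
      unfolding \<rho>_def by (intro monoI subset_cball add_left_mono power_increasing) auto
    then have "(\<lambda>n. measure (\<mu> j) (cball 0 (\<rho> n))) \<longlonglongrightarrow> measure (\<mu> j) (\<Union>n. cball 0 (\<rho> n))"
      by (intro finite_Lim_measure_incseq) (auto simp: sets_M)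
    also have "(\<Union>n. cball (0 :: real ^ 'd) (\<rho> n)) = UNIV"
    proof -
      have "\<exists>n. x \<in> cball 0 (\<rho> n)" for x :: "real ^ 'd"
      proof -
        obtain n where "norm x < (1 / c_max) ^ n"
          using real_arch_pow[OF one_less] by blast
        then show ?thesis
          using R0 by (intro exI[of _ n]) (simp add: \<rho>_def)
      qed
      then show ?thesis
        by blast
    qed
    finally show ?thesis
      using prob_space space_M by simp
  qed
  have "t \<le> measure (\<mu> i) (cball 0 (\<rho> 0))" if "t < 1" for t
  proof -
    have "\<forall>\<^sub>F n in sequentially. \<forall>j\<in>verts G. t < measure (\<mu> j) (cball 0 (\<rho> n))"
      using lim that by (intro eventually_ball_finite ballI) (auto dest: order_tendstoD(1))
    then obtain n where "\<forall>j\<in>verts G. t < measure (\<mu> j) (cball 0 (\<rho> n))"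
      using eventually_happens'[OF sequentially_bot] by blast
    then show ?thesis
      using descend[of t n] i by (auto intro: less_imp_le)
  qed
  then have "1 \<le> measure (\<mu> i) (cball 0 (\<rho> 0))"
    by (rule dense_le)
  moreover have "measure (\<mu> i) (cball 0 (\<rho> 0)) \<le> 1"
    using borel_prob_space_\<mu>[OF i] by (simp add: borel_prob_space_def prob_space.prob_le_1)
  moreover have "\<rho> 0 = attractor_radius"
    by (simp add: \<rho>_def R0_def attractor_radius_def)
  ultimately show ?thesis
    by simp
qed

lemma measure_eq_0_if_disjoint:
  assumes i: "i \<in> verts G" and "A \<in> sets borel" "A \<inter> cball 0 attractor_radius = {}"
  shows "measure (\<mu> i) A = 0"
proof -
  interpret borel_prob_space "\<mu> i"
    using i by (rule borel_prob_space_\<mu>)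
  have "measure (\<mu> i) (A \<union> cball 0 attractor_radius) = measure (\<mu> i) A + 1"
    using assms by (subst finite_measure_Union) (auto simp: sets_M measure_attractor_ball)
  then show ?thesis
    using prob_le_1[of "A \<union> cball 0 attractor_radius"] measure_nonneg[of "\<mu> i" A] by simp
qed

text \<open>A charged ball receives mass through some arc, and pulling back along it gives a charged
  ball at the head. After \<open>n\<close> such steps an enlargement by
  \<open>2 * attractor_radius\<close> swallows the whole carrying ball. On the way back each step
  costs a factor of at least \<open>p_min\<close> in mass and multiplies the enlargement by at most
  \<open>c_max\<close>.\<close>

lemma measure_cball_lower_bound:
  assumes "i \<in> verts G" "0 < measure (\<mu> i) (cball x \<delta>)"
  shows "p_min ^ n \<le> measure (\<mu> i) (cball x (\<delta> + 2 * attractor_radius * c_max ^ n))"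
  using assms
proof (induction n arbitrary: i x \<delta>)
  case 0
  interpret borel_prob_space "\<mu> i"
    using 0 by (intro borel_prob_space_\<mu>)
  have "cball x \<delta> \<inter> cball 0 attractor_radius \<noteq> {}"
    using measure_eq_0_if_disjoint[OF 0(1), of "cball x \<delta>"] 0(2) by force
  then obtain y where "dist x y \<le> \<delta>" "norm y \<le> attractor_radius"
    by auto
  then have "norm x \<le> \<delta> + attractor_radius"
    using norm_triangle_sub[of x y] by (simp add: dist_norm)
  then have "cball 0 attractor_radius \<subseteq> cball x (\<delta> + 2 * attractor_radius)"
    by (auto simp: cball_subset_cball_iff)
  then have "measure (\<mu> i) (cball 0 attractor_radius) \<le> measure (\<mu> i) (cball x (\<delta> + 2 * attractor_radius))"
    by (rule measure_cball_mono)
  then show ?case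
    using measure_attractor_ball[OF 0(1)] by simp
next
  case (Suc n)
  have "\<exists>e\<in>out_arcs G i. p e * measure (\<mu> (head G e)) (S e -` cball x \<delta>) \<noteq> 0"
  proof (rule ccontr)
    assume "\<not> ?thesis"
    then have "measure (\<mu> i) (cball x \<delta>) = 0"
      using measure_self_similar[OF Suc.prems(1), of "cball x \<delta>"] by (auto intro!: sum.neutral)
    then show False
      using Suc.prems by simp
  qed
  then obtain e where e: "e \<in> out_arcs G i" and pos: "measure (\<mu> (head G e)) (S e -` cball x \<delta>) \<noteq> 0"
    by auto
  then have e': "e \<in> arcs G"
    by simp
  interpret borel_prob_space "\<mu> (head G e)"
    using e' by (intro borel_prob_space_\<mu>) simp
  obtain y where y: "x = S e y"
    using similarity_map_surj[OF similarity[OF e']] ratio[OF e'] by (metis surjD)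
  note vimage = similarity_map_vimage_cball[OF similarity[OF e'], of y, folded y]
  have "p_min ^ n \<le> measure (\<mu> (head G e)) (cball y (\<delta> / c e + 2 * attractor_radius * c_max ^ n))"
    using pos vimage ratio[OF e'] e' by (intro Suc.IH) (auto simp: less_le)
  also have "\<dots> \<le> measure (\<mu> (head G e)) (S e -` cball x (\<delta> + 2 * attractor_radius * c_max ^ Suc n))"
  proof -
    have "c e * (2 * attractor_radius * c_max ^ n) \<le> c_max * (2 * attractor_radius * c_max ^ n)"
      using c_le_c_max[OF e'] c_max_pos attractor_radius_ge_one by (intro mult_right_mono) auto
    then have "\<delta> / c e + 2 * attractor_radius * c_max ^ n \<le> (\<delta> + 2 * attractor_radius * c_max ^ Suc n) / c e"
      using ratio[OF e'] by (simp add: field_simps)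
    then show ?thesis
      using vimage ratio[OF e'] by (auto intro!: measure_cball_mono)
  qed
  finally have "p_min * p_min ^ n
      \<le> p e * measure (\<mu> (head G e)) (S e -` cball x (\<delta> + 2 * attractor_radius * c_max ^ Suc n))"
    using p_min_le[OF e'] p_min_pos by (intro mult_mono) auto
  also have "\<dots> \<le> (\<Sum>e\<in>out_arcs G i. p e * measure (\<mu> (head G e)) (S e -` cball x (\<delta> + 2 * attractor_radius * c_max ^ Suc n)))"
    using e prob by (intro member_le_sum) (auto intro!: mult_nonneg_nonneg simp: less_imp_le)
  also have "\<dots> = measure (\<mu> i) (cball x (\<delta> + 2 * attractor_radius * c_max ^ Suc n))"
    using Suc.prems by (intro measure_self_similar[symmetric]) auto
  finally show ?case
    by simp
qed

section \<open>Words and decompositions at a given scale\<close>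

primrec word_map :: "'e list \<Rightarrow> real ^ 'd \<Rightarrow> real ^ 'd" where
  "word_map [] = id"
| "word_map (e # w) = S e \<circ> word_map w"

primrec word_end :: "nat \<Rightarrow> 'e list \<Rightarrow> nat" where
  "word_end i [] = i"
| "word_end i (e # w) = word_end (head G e) w"

abbreviation word_ratio :: "'e list \<Rightarrow> real" where
  "word_ratio w \<equiv> prod_list (map c w)"

abbreviation word_prob :: "'e list \<Rightarrow> real" where
  "word_prob w \<equiv> prod_list (map p w)"

lemma word_ratio_pos: "set w \<subseteq> arcs G \<Longrightarrow> 0 < word_ratio w"
  and word_prob_pos: "set w \<subseteq> arcs G \<Longrightarrow> 0 < word_prob w"
  using ratio prob by (induction w) auto

lemma similarity_word_map:
  "set w \<subseteq> arcs G \<Longrightarrow> similarity_map (word_ratio w) (word_map w)"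
proof (induction w)
  case (Cons e w)
  then show ?case
    using similarity[of e] by (auto simp: similarity_map_def)
qed (auto simp: similarity_map_def)

text \<open>
  Instead of requiring \<open>W\<close> to be a section of the tree of paths from \<open>i\<close>, the definition records
  the decomposition of \<open>\<mu> i\<close> at scale \<open>r\<close> that such a section provides.
\<close>
definition is_cut :: "nat \<Rightarrow> real \<Rightarrow> 'e list set \<Rightarrow> bool" where
  "is_cut i r W \<longleftrightarrow> finite W \<and>
    (\<forall>w\<in>W. set w \<subseteq> arcs G \<and> word_end i w \<in> verts G \<and> c_min * r \<le> word_ratio w \<and> word_ratio w \<le> r) \<and>
    (\<forall>A\<in>sets borel. measure (\<mu> i) A
      = (\<Sum>w\<in>W. word_prob w * measure (\<mu> (word_end i w)) (word_map w -` A)))"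

lemma is_cut_finite: "is_cut i r W \<Longrightarrow> finite W"
  and is_cut_word: "is_cut i r W \<Longrightarrow> w \<in> W \<Longrightarrow> set w \<subseteq> arcs G \<and> word_end i w \<in> verts G
    \<and> c_min * r \<le> word_ratio w \<and> word_ratio w \<le> r"
  and is_cut_measure: "is_cut i r W \<Longrightarrow> A \<in> sets borel \<Longrightarrow>
    measure (\<mu> i) A = (\<Sum>w\<in>W. word_prob w * measure (\<mu> (word_end i w)) (word_map w -` A))"
  unfolding is_cut_def by blast+

lemma is_cut_Nil: "i \<in> verts G \<Longrightarrow> 1 \<le> r \<Longrightarrow> c_min * r \<le> 1 \<Longrightarrow> is_cut i r {[]}"
  by (simp add: is_cut_def)

text \<open>One application of self-similarity at \<open>i\<close>: prefixing \<open>e\<close>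
  multiplies both bounds on the word ratio by \<open>c e\<close>, which turns a cut at scale
  \<open>r / c e\<close> into one at scale \<open>r\<close>.\<close>

lemma is_cut_Cons:
  assumes i: "i \<in> verts G" and W: "\<And>e. e \<in> out_arcs G i \<Longrightarrow> is_cut (head G e) (r / c e) (W e)"
  shows "is_cut i r (\<Union>e\<in>out_arcs G i. (#) e ` W e)"
  unfolding is_cut_def
proof (intro conjI ballI)
  show "finite (\<Union>e\<in>out_arcs G i. (#) e ` W e)"
    using W by (auto simp: is_cut_def)
next
  fix w assume "w \<in> (\<Union>e\<in>out_arcs G i. (#) e ` W e)"
  then obtain e v where e: "e \<in> out_arcs G i" "v \<in> W e" "w = e # v"
    by blast
  with W[of e] ratio[of e]
  show "set w \<subseteq> arcs G" "word_end i w \<in> verts G" "c_min * r \<le> word_ratio w" "word_ratio w \<le> r"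
    by (auto simp: is_cut_def field_simps)
next
  fix A :: "(real ^ 'd) set" assume A: "A \<in> sets borel"
  have "(\<Sum>w\<in>(\<Union>e\<in>out_arcs G i. (#) e ` W e). word_prob w * measure (\<mu> (word_end i w)) (word_map w -` A))
      = (\<Sum>e\<in>out_arcs G i. \<Sum>w\<in>(#) e ` W e. word_prob w * measure (\<mu> (word_end i w)) (word_map w -` A))"
    using W by (intro sum.UNION_disjoint) (auto simp: is_cut_def)
  also have "\<dots> = (\<Sum>e\<in>out_arcs G i. p e * measure (\<mu> (head G e)) (S e -` A))"
  proof (rule sum.cong[OF refl])
    fix e assume e: "e \<in> out_arcs G i"
    then have "S e -` A \<in> sets borel"
      using A by (intro S_vimage_measurable) auto
    then have "measure (\<mu> (head G e)) (S e -` A)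
        = (\<Sum>w\<in>W e. word_prob w * measure (\<mu> (word_end (head G e) w)) (word_map w -` (S e -` A)))"
      using W[OF e] by (simp add: is_cut_def)
    then show "(\<Sum>w\<in>(#) e ` W e. word_prob w * measure (\<mu> (word_end i w)) (word_map w -` A))
        = p e * measure (\<mu> (head G e)) (S e -` A)"
      by (simp add: sum.reindex sum_distrib_left vimage_comp mult.assoc)
  qed
  also have "\<dots> = measure (\<mu> i) A"
    using i A by (rule measure_self_similar[symmetric])
  finally show "measure (\<mu> i) A
    = (\<Sum>w\<in>(\<Union>e\<in>out_arcs G i. (#) e ` W e). word_prob w * measure (\<mu> (word_end i w)) (word_map w -` A))" ..
qed

text \<open>A word is extended only while \<open>r < 1\<close>. Then
  \<open>c_min * (r / c e) \<le> 1\<close> persists because \<open>c_min \<le> c e\<close>, and this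
  invariant is the lower ratio bound when the recursion stops at the empty word. Each step divides
  \<open>r\<close> by at most \<open>c_max\<close>, so \<open>n\<close> steps suffice.\<close>

lemma is_cut_exists_aux:
  assumes "i \<in> verts G" "c_max ^ n \<le> r" "c_min * r \<le> 1"
  shows "\<exists>W. is_cut i r W"
  using assms
proof (induction n arbitrary: i r)
  case 0
  then show ?case
    using is_cut_Nil by auto
next
  case (Suc n)
  have "0 < r"
    using Suc.prems c_max_pos by (metis less_le_trans zero_less_power)
  show ?case
  proof (cases "1 \<le> r")
    case True
    then show ?thesis
      using is_cut_Nil Suc.prems by blast
  next
    case False
    have "\<exists>W. is_cut (head G e) (r / c e) W" if "e \<in> out_arcs G i" for e
    proof (rule Suc.IH)
      have e: "e \<in> arcs G"
        using that by simp
      then show "head G e \<in> verts G"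
        by simp
      have "c e * c_max ^ n \<le> c_max * c_max ^ n"
        using c_le_c_max[OF e] c_max_pos by (intro mult_right_mono) auto
      then show "c_max ^ n \<le> r / c e"
        using Suc.prems ratio[OF e] by (simp add: field_simps)
      have "c_min * r \<le> c e * 1"
        using c_min_le[OF e] c_min_pos False \<open>0 < r\<close> by (intro mult_mono) auto
      then show "c_min * (r / c e) \<le> 1"
        using ratio[OF e] by (simp add: field_simps)
    qed
    then obtain W where "\<And>e. e \<in> out_arcs G i \<Longrightarrow> is_cut (head G e) (r / c e) (W e)"
      by metis
    then show ?thesis
      using is_cut_Cons[OF Suc.prems(1)] by blast
  qed
qed

lemma is_cut_exists:
  assumes "i \<in> verts G" "0 < r" "r \<le> 1"
  shows "\<exists>W. is_cut i r W"
proof -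
  obtain n where "c_max ^ n < r"
    using real_arch_pow_inv[OF assms(2) c_max_less_one] by blast
  moreover have "c_min * r \<le> 1"
    using mult_mono[of c_min 1 r 1] assms c_min_less_one c_min_pos by simp
  ultimately show ?thesis
    using is_cut_exists_aux[of i n r] assms by auto
qed

lemma word_vimage_inverse:
  assumes "set w \<subseteq> arcs G"
  obtains g where "similarity_map (1 / word_ratio w) g" "g \<in> borel_measurable borel"
    "\<And>z s. word_map w -` cball z s = cball (g z) (s / word_ratio w)"
proof -
  obtain g where g: "similarity_map (1 / word_ratio w) g"
    "\<And>z s. word_map w -` cball z s = cball (g z) (s / word_ratio w)"
    using similarity_map_inverse[OF similarity_word_map word_ratio_pos] assms by blast
  moreover have "g \<in> borel_measurable borel"
    using g(1) word_ratio_pos[OF assms] by (intro similarity_map_measurable[of "1 / word_ratio w"]) auto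
  ultimately show ?thesis
    using that by blast
qed

lemma measurable_word_vimage_cball:
  assumes "set w \<subseteq> arcs G" "j \<in> verts G"
  shows "(\<lambda>z. measure (\<mu> j) (word_map w -` cball z s)) \<in> borel_measurable borel"
proof -
  interpret borel_prob_space "\<mu> j"
    using assms by (intro borel_prob_space_\<mu>)
  obtain g where "similarity_map (1 / word_ratio w) g" and [measurable]: "g \<in> borel_measurable borel"
    and eq: "\<And>z s. word_map w -` cball z s = cball (g z) (s / word_ratio w)"
    by (rule word_vimage_inverse[OF assms(1)]) (rule that)
  show ?thesis
    unfolding eq by measurable
qed

text \<open>Exact scaling of the moment: the preimage is a ball around \<open>g z\<close>, where
  \<open>g\<close> is a similarity with the inverse ratio.\<close>

lemma nn_integral_word_vimage_cball:
  assumes "set w \<subseteq> arcs G" "j \<in> verts G"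
  shows "(\<integral>\<^sup>+z. ennreal (measure (\<mu> j) (word_map w -` cball z s) powr q) \<partial>lborel)
    = ennreal (word_ratio w ^ DIM(real ^ 'd)) * ball_moment (\<mu> j) q (s / word_ratio w)"
proof -
  interpret borel_prob_space "\<mu> j"
    using assms by (intro borel_prob_space_\<mu>)
  obtain g where g: "similarity_map (1 / word_ratio w) g" and "g \<in> borel_measurable borel"
    and eq: "\<And>z s. word_map w -` cball z s = cball (g z) (s / word_ratio w)"
    by (rule word_vimage_inverse[OF assms(1)]) (rule that)
  define h where "h y = ennreal (measure (\<mu> j) (cball y (s / word_ratio w)) powr q)" for y
  have [measurable]: "h \<in> borel_measurable borel"
    unfolding h_def by measurable
  define a where "a = word_ratio w ^ DIM(real ^ 'd)"
  have a: "0 < a"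
    using word_ratio_pos[OF assms(1)] by (simp add: a_def)
  have "ball_moment (\<mu> j) q (s / word_ratio w) = ennreal ((1 / word_ratio w) ^ DIM(real ^ 'd)) * (\<integral>\<^sup>+z. h (g z) \<partial>lborel)"
    unfolding ball_moment_def h_def[symmetric]
    using word_ratio_pos[OF assms(1)] by (intro nn_integral_lborel_similarity g) auto
  also have "(1 / word_ratio w) ^ DIM(real ^ 'd) = 1 / a"
    by (simp add: a_def power_one_over)
  finally have "ennreal a * ball_moment (\<mu> j) q (s / word_ratio w)
      = (ennreal a * ennreal (1 / a)) * (\<integral>\<^sup>+z. h (g z) \<partial>lborel)"
    by (simp add: mult.assoc)
  also have "ennreal a * ennreal (1 / a) = 1"
    using a by (subst ennreal_mult[symmetric]) auto
  finally show ?thesis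
    by (simp add: h_def eq a_def)
qed

lemma word_map_vimage_borel:
  assumes "set w \<subseteq> arcs G" "A \<in> sets borel"
  shows "word_map w -` A \<in> sets borel"
  using measurable_sets[OF similarity_map_measurable[OF similarity_word_map word_ratio_pos] assms(2)] assms(1)
  by simp

text \<open>The piece of the word \<open>w\<close> is carried by a ball around
  \<open>word_map w 0\<close> of radius \<open>word_ratio w * attractor_radius\<close>. Read
  contrapositively, this tells which pieces can be discarded near \<open>z\<close>.\<close>

lemma dist_word_map_0_le:
  assumes w: "set w \<subseteq> arcs G" and j: "j \<in> verts G"
    and nz: "measure (\<mu> j) (word_map w -` cball z s) \<noteq> 0"
  shows "dist z (word_map w 0) \<le> s + word_ratio w * attractor_radius"
proof -
  have "word_map w -` cball z s \<inter> cball 0 attractor_radius \<noteq> {}"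
    using measure_eq_0_if_disjoint[OF j word_map_vimage_borel[OF w], of "cball z s"] nz by auto
  then obtain y where y: "dist z (word_map w y) \<le> s" "norm y \<le> attractor_radius"
    by auto
  have "dist (word_map w y) (word_map w 0) = word_ratio w * norm y"
    using similarity_word_map[OF w] by (simp add: similarity_map_def)
  also have "\<dots> \<le> word_ratio w * attractor_radius"
    using y word_ratio_pos[OF w] by (intro mult_left_mono) auto
  finally show ?thesis
    using y dist_triangle[of z "word_map w 0" "word_map w y"] by linarith
qed

lemma measure_word_vimage_eq_1:
  assumes w: "set w \<subseteq> arcs G" and j: "j \<in> verts G"
    and le: "dist x (word_map w 0) + word_ratio w * attractor_radius \<le> s"
  shows "measure (\<mu> j) (word_map w -` cball x s) = 1"
proof -
  interpret borel_prob_space "\<mu> j"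
    using j by (rule borel_prob_space_\<mu>)
  have "cball 0 attractor_radius \<subseteq> word_map w -` cball x s"
  proof
    fix y assume y: "y \<in> cball (0 :: real ^ 'd) attractor_radius"
    have "dist (word_map w 0) (word_map w y) = word_ratio w * norm y"
      using similarity_word_map[OF w] by (simp add: similarity_map_def)
    also have "\<dots> \<le> word_ratio w * attractor_radius"
      using y word_ratio_pos[OF w] by (intro mult_left_mono) auto
    finally show "y \<in> word_map w -` cball x s"
      using le dist_triangle[of x "word_map w y" "word_map w 0"] by simp
  qed
  then have "1 \<le> measure (\<mu> j) (word_map w -` cball x s)"
    unfolding measure_attractor_ball[OF j, symmetric]
    using word_map_vimage_borel[OF w] by (intro finite_measure_mono) (auto simp: sets_M)
  then show ?thesis
    using prob_le_1 by (intro antisym)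
qed

section \<open>Comparing the moments at different vertices\<close>

lemma ball_moment_edge:
  assumes e: "e \<in> arcs G" and q: "0 \<le> q" and \<delta>: "0 < \<delta>"
  shows "ennreal (p_min powr q * c_min ^ DIM(real ^ 'd)) * ball_moment (\<mu> (head G e)) q \<delta>
    \<le> ball_moment (\<mu> (tail G e)) q \<delta>"
proof -
  interpret borel_prob_space "\<mu> (head G e)"
    using e by (intro borel_prob_space_\<mu>) simp
  define h where "h z = measure (\<mu> (head G e)) (word_map [e] -` cball z \<delta>)" for z
  have [measurable]: "h \<in> borel_measurable borel"
    unfolding h_def using e by (intro measurable_word_vimage_cball) auto
  have "c_min ^ DIM(real ^ 'd) \<le> c e ^ DIM(real ^ 'd)"
    using c_min_le[OF e] c_min_pos by (intro power_mono) auto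
  \<comment> \<open>Contraction costs volume, bounded through \<open>c_min\<close>, but it enlarges
    the radius after pulling back, which can only increase the moment.\<close>
  moreover have "\<delta> \<le> \<delta> / c e"
    using ratio[OF e] \<delta> by (simp add: field_simps)
  ultimately have "ennreal (c_min ^ DIM(real ^ 'd)) * ball_moment (\<mu> (head G e)) q \<delta>
      \<le> ennreal (c e ^ DIM(real ^ 'd)) * ball_moment (\<mu> (head G e)) q (\<delta> / c e)"
    using q by (intro mult_mono ennreal_leI ball_moment_mono) auto
  also have "\<dots> = (\<integral>\<^sup>+z. ennreal (h z powr q) \<partial>lborel)"
    unfolding h_def using e by (subst nn_integral_word_vimage_cball) auto
  finally have "ennreal (p_min powr q) * (ennreal (c_min ^ DIM(real ^ 'd)) * ball_moment (\<mu> (head G e)) q \<delta>)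
      \<le> ennreal (p_min powr q) * (\<integral>\<^sup>+z. ennreal (h z powr q) \<partial>lborel)"
    by (intro mult_left_mono) auto
  also have "\<dots> = (\<integral>\<^sup>+z. ennreal (p_min powr q) * ennreal (h z powr q) \<partial>lborel)"
    by (intro nn_integral_cmult[symmetric]) measurable
  also have "\<dots> \<le> ball_moment (\<mu> (tail G e)) q \<delta>"
    unfolding ball_moment_def
  proof (rule nn_integral_mono)
    fix z
    have "p_min * h z \<le> p e * h z"
      using p_min_le[OF e] by (intro mult_right_mono) (auto simp: h_def)
    also have "\<dots> = p e * measure (\<mu> (head G e)) (S e -` cball z \<delta>)"
      by (simp add: h_def)
    also have "\<dots> \<le> (\<Sum>e\<in>out_arcs G (tail G e). p e * measure (\<mu> (head G e)) (S e -` cball z \<delta>))"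
      using e prob
      by (intro member_le_sum[where f = "\<lambda>e. p e * measure (\<mu> (head G e)) (S e -` cball z \<delta>)"])
         (auto intro!: mult_nonneg_nonneg simp: less_imp_le)
    also have "\<dots> = measure (\<mu> (tail G e)) (cball z \<delta>)"
      using e by (intro measure_self_similar[symmetric]) auto
    finally have "(p_min * h z) powr q \<le> measure (\<mu> (tail G e)) (cball z \<delta>) powr q"
      using q p_min_pos by (intro powr_mono2) (auto simp: h_def)
    then show "ennreal (p_min powr q) * ennreal (h z powr q) \<le> ennreal (measure (\<mu> (tail G e)) (cball z \<delta>) powr q)"
      using p_min_pos by (subst ennreal_mult[symmetric]) (auto simp: powr_mult h_def intro!: ennreal_leI)
  qed
  finally show ?thesis
    by (simp add: ennreal_mult mult.assoc c_min_pos less_imp_le)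
qed

text \<open>The one-arc bounds multiply along a directed path from \<open>i\<close> to
  \<open>j\<close>. The resulting constant does not depend on \<delta>, so the growth exponents at
  all vertices agree.\<close>

lemma ball_moment_comparable:
  assumes "i \<in> verts G" "j \<in> verts G" and q: "0 \<le> q"
  shows "\<exists>\<kappa>>0. \<forall>\<delta>>0. ennreal \<kappa> * ball_moment (\<mu> j) q \<delta> \<le> ball_moment (\<mu> i) q \<delta>"
proof -
  have "i \<rightarrow>\<^sup>*\<^bsub>G\<^esub> j"
    using connected assms by (auto simp: strongly_connected_def)
  then show ?thesis
  proof (induction rule: converse_reachable_induct)
    case base
    show ?case
      by (intro exI[of _ 1]) auto
  next
    case (step x y)
    then obtain \<kappa> where \<kappa>: "\<kappa> > 0" "\<And>\<delta>. \<delta> > 0 \<Longrightarrow> ennreal \<kappa> * ball_moment (\<mu> j) q \<delta> \<le> ball_moment (\<mu> y) q \<delta>"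
      by blast
    obtain e where e: "e \<in> arcs G" "tail G e = x" "head G e = y"
      using step(1) by blast
    define k where "k = p_min powr q * c_min ^ DIM(real ^ 'd)"
    have k: "k > 0"
      using p_min_pos c_min_pos by (simp add: k_def)
    have "ennreal (k * \<kappa>) * ball_moment (\<mu> j) q \<delta> \<le> ball_moment (\<mu> x) q \<delta>" if "\<delta> > 0" for \<delta>
    proof -
      have "ennreal (k * \<kappa>) * ball_moment (\<mu> j) q \<delta> = ennreal k * (ennreal \<kappa> * ball_moment (\<mu> j) q \<delta>)"
        using k \<kappa> by (simp add: ennreal_mult mult.assoc)
      also have "\<dots> \<le> ennreal k * ball_moment (\<mu> y) q \<delta>"
        using \<kappa>(2)[OF that] by (intro mult_left_mono) auto
      also have "\<dots> \<le> ball_moment (\<mu> x) q \<delta>"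
        using ball_moment_edge[OF e(1) q that] e by (simp add: k_def)
      finally show ?thesis .
    qed
    then show ?case
      using k \<kappa> by (intro exI[of _ "k * \<kappa>"]) auto
  qed
qed

section \<open>Two-scale estimates near a point\<close>

lemma is_cut_measure_cball:
  assumes "is_cut i r W" "Y \<subseteq> W"
    and "\<And>w. w \<in> W - Y \<Longrightarrow> measure (\<mu> (word_end i w)) (word_map w -` cball z s) = 0"
  shows "measure (\<mu> i) (cball z s)
    = (\<Sum>w\<in>Y. word_prob w * measure (\<mu> (word_end i w)) (word_map w -` cball z s))"
proof -
  have "measure (\<mu> i) (cball z s)
      = (\<Sum>w\<in>W. word_prob w * measure (\<mu> (word_end i w)) (word_map w -` cball z s))"
    using assms(1) by (intro is_cut_measure) auto
  also have "\<dots> = (\<Sum>w\<in>Y. word_prob w * measure (\<mu> (word_end i w)) (word_map w -` cball z s))"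
  proof (rule sum.mono_neutral_right)
    show "\<forall>w\<in>W - Y. word_prob w * measure (\<mu> (word_end i w)) (word_map w -` cball z s) = 0"
      using assms(3) by simp
  qed (use is_cut_finite[OF assms(1)] assms(2) in auto)
  finally show ?thesis .
qed

text \<open>
  Only the pieces of \<open>\<mu> i\<close> at scale \<open>r\<close> that lie near \<open>x\<close> are kept; together they carry at least
  the mass of \<open>cball x r\<close>, and Jensen's inequality for the concave power separates them.
\<close>
lemma ball_moment_lower_local:
  assumes i: "i \<in> verts G" and cut: "is_cut i r W" and r: "0 < r" and \<epsilon>: "0 < \<epsilon>" "\<epsilon> \<le> 1"
    and q: "0 \<le> q" "q \<le> 1" and m: "\<And>j. j \<in> verts G \<Longrightarrow> m \<le> ball_moment (\<mu> j) q \<epsilon>"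
  shows "ennreal (measure (\<mu> i) (cball x r) powr q) * (ennreal ((c_min * r) ^ DIM(real ^ 'd)) * m)
    \<le> (\<integral>\<^sup>+z. indicator (cball x (2 * (1 + attractor_radius) * r)) z
        * ennreal (measure (\<mu> i) (cball z (r * \<epsilon>)) powr q) \<partial>lborel)"
proof -
  define R where "R = attractor_radius"
  \<comment> \<open>A piece that charges \<open>cball x r\<close> has its centre within
    \<open>r + word_ratio w * R\<close>, and \<open>word_ratio w \<le> r\<close>.\<close>
  define Y where "Y = {w \<in> W. dist x (word_map w 0) \<le> (1 + R) * r}"
  define P where "P = (\<Sum>w\<in>Y. word_prob w)"
  define h where "h w z = measure (\<mu> (word_end i w)) (word_map w -` cball z (r * \<epsilon>))" for w z
  define B where "B = cball x (2 * (1 + R) * r)"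
  define X where "X = ennreal ((c_min * r) ^ DIM(real ^ 'd)) * m"
  have [simp]: "finite Y"
    using is_cut_finite[OF cut] by (simp add: Y_def)
  have W: "set w \<subseteq> arcs G" "word_end i w \<in> verts G" "c_min * r \<le> word_ratio w" "word_ratio w \<le> r"
    if "w \<in> W" for w
    using is_cut_word[OF cut that] by simp_all
  have YW: "w \<in> W" if "w \<in> Y" for w
    using that by (simp add: Y_def)
  have p_nonneg: "0 \<le> word_prob w" if "w \<in> W" for w
    using word_prob_pos[OF W(1)[OF that]] by simp
  have [measurable]: "h w \<in> borel_measurable borel" if "w \<in> Y" for w
    unfolding h_def using W[OF YW[OF that]] by (intro measurable_word_vimage_cball)
  have R: "1 \<le> R"
    using attractor_radius_ge_one by (simp add: R_def)
  have ratio_R: "word_ratio w * R \<le> r * R" if "w \<in> W" for w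
    using W[OF that] R by (intro mult_right_mono) auto
  have r\<epsilon>: "r * \<epsilon> \<le> r"
    using r \<epsilon> by (simp add: mult_left_le)
  have P_nonneg: "0 \<le> P"
    unfolding P_def using p_nonneg YW by (intro sum_nonneg) auto

  have "measure (\<mu> i) (cball x r)
      = (\<Sum>w\<in>Y. word_prob w * measure (\<mu> (word_end i w)) (word_map w -` cball x r))"
  proof (rule is_cut_measure_cball[OF cut])
    fix w assume w: "w \<in> W - Y"
    show "measure (\<mu> (word_end i w)) (word_map w -` cball x r) = 0"
    proof (rule ccontr)
      assume "\<not> ?thesis"
      then show False
        using w W[of w] dist_word_map_0_le[of w "word_end i w" x r] ratio_R[of w]
        by (auto simp: Y_def R_def algebra_simps)
    qed
  qed (auto simp: Y_def)
  also have "\<dots> \<le> P"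
    unfolding P_def
  proof (rule sum_mono)
    fix w assume "w \<in> Y"
    then interpret borel_prob_space "\<mu> (word_end i w)"
      using W(2)[OF YW] by (intro borel_prob_space_\<mu>) blast
    show "word_prob w * measure (\<mu> (word_end i w)) (word_map w -` cball x r) \<le> word_prob w"
      using p_nonneg[OF YW[OF \<open>w \<in> Y\<close>]] by (intro mult_left_le) auto
  qed
  finally have "measure (\<mu> i) (cball x r) powr q \<le> P powr q"
    using q by (intro powr_mono2) auto
  \<comment> \<open>One factor \<open>P\<close> is written as a sum so that every weight can be
    paired with the moment of its own piece, as on the left of Jensen's inequality.\<close>
  also have "\<dots> = P powr (q - 1) * (\<Sum>w\<in>Y. word_prob w)"
    unfolding P_def[symmetric] using P_nonneg by (rule powr_eq_mult_powr_pred)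
  finally have "ennreal (measure (\<mu> i) (cball x r) powr q) * X
      \<le> ennreal (P powr (q - 1) * (\<Sum>w\<in>Y. word_prob w)) * X"
    by (intro mult_right_mono ennreal_leI) auto
  also have "\<dots> = ennreal (P powr (q - 1)) * ((\<Sum>w\<in>Y. ennreal (word_prob w)) * X)"
    using p_nonneg YW by (simp add: ennreal_mult' mult.assoc sum_ennreal)
  also have "\<dots> = ennreal (P powr (q - 1)) * (\<Sum>w\<in>Y. ennreal (word_prob w) * X)"
    by (simp only: sum_distrib_right)
  also have "\<dots> \<le> ennreal (P powr (q - 1)) * (\<Sum>w\<in>Y. ennreal (word_prob w) * (\<integral>\<^sup>+z. indicator B z * ennreal (h w z powr q) \<partial>lborel))"
  proof (intro mult_left_mono sum_mono)
    fix w assume "w \<in> Y"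
    then have w: "w \<in> W"
      by (rule YW)
    interpret borel_prob_space "\<mu> (word_end i w)"
      using W(2)[OF w] by (rule borel_prob_space_\<mu>)
    have "m \<le> ball_moment (\<mu> (word_end i w)) q \<epsilon>"
      using m W(2)[OF w] .
    also have "\<dots> \<le> ball_moment (\<mu> (word_end i w)) q (r * \<epsilon> / word_ratio w)"
    proof (rule ball_moment_mono[OF q(1)])
      have "word_ratio w * \<epsilon> \<le> r * \<epsilon>"
        using W(4)[OF w] \<epsilon> by (intro mult_right_mono) auto
      then show "\<epsilon> \<le> r * \<epsilon> / word_ratio w"
        using word_ratio_pos[OF W(1)[OF w]] by (simp add: field_simps)
    qed
    finally have "X \<le> ennreal (word_ratio w ^ DIM(real ^ 'd)) * ball_moment (\<mu> (word_end i w)) q (r * \<epsilon> / word_ratio w)"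
      unfolding X_def using W(3)[OF w] c_min_pos r
      by (intro mult_mono ennreal_leI power_mono) auto
    also have "\<dots> = (\<integral>\<^sup>+z. ennreal (h w z powr q) \<partial>lborel)"
      unfolding h_def using W[OF w] by (intro nn_integral_word_vimage_cball[symmetric])
    \<comment> \<open>The pieces in \<open>Y\<close> are invisible outside \<open>B\<close>: centres
      within \<open>(1 + R) * r\<close> of \<open>x\<close>, ball radius
      \<open>r * \<epsilon> \<le> r\<close> and piece radius at most \<open>R * r\<close> add up to
      \<open>2 * (1 + R) * r\<close>.\<close>
    also have "\<dots> = (\<integral>\<^sup>+z. indicator B z * ennreal (h w z powr q) \<partial>lborel)"
    proof (rule nn_integral_cong)
      fix z
      show "ennreal (h w z powr q) = indicator B z * ennreal (h w z powr q)"
      proof (cases "h w z = 0")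
        case False
        have "dist x z \<le> dist x (word_map w 0) + dist z (word_map w 0)"
          by (metis dist_commute dist_triangle)
        also have "\<dots> \<le> (1 + R) * r + (r * \<epsilon> + word_ratio w * R)"
          using dist_word_map_0_le[OF W(1,2)[OF w], of z "r * \<epsilon>"] False \<open>w \<in> Y\<close>
          by (intro add_mono) (auto simp: Y_def h_def R_def)
        also have "\<dots> \<le> 2 * (1 + R) * r"
          using ratio_R[OF w] r\<epsilon> by (simp add: algebra_simps)
        finally show ?thesis
          by (simp add: B_def)
      qed simp
    qed
    finally show "X \<le> (\<integral>\<^sup>+z. indicator B z * ennreal (h w z powr q) \<partial>lborel)" .
  qed auto
  also have "\<dots> = (\<integral>\<^sup>+z. ennreal (P powr (q - 1)) * (\<Sum>w\<in>Y. ennreal (word_prob w) * (indicator B z * ennreal (h w z powr q))) \<partial>lborel)"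
  proof -
    have [measurable]: "B \<in> sets borel"
      by (simp add: B_def)
    show ?thesis
      by (simp add: nn_integral_cmult nn_integral_sum)
  qed
  also have "\<dots> \<le> (\<integral>\<^sup>+z. indicator B z * ennreal (measure (\<mu> i) (cball z (r * \<epsilon>)) powr q) \<partial>lborel)"
  proof (rule nn_integral_mono)
    fix z
    have "P powr (q - 1) * (\<Sum>w\<in>Y. word_prob w * h w z powr q) \<le> (\<Sum>w\<in>Y. word_prob w * h w z) powr q"
      unfolding P_def using p_nonneg YW q by (intro sum_powr_le_powr_sum) (auto simp: h_def)
    also have "\<dots> \<le> (\<Sum>w\<in>W. word_prob w * h w z) powr q"
      using p_nonneg YW q is_cut_finite[OF cut]
      by (intro powr_mono2 sum_mono2 sum_nonneg) (auto simp: h_def)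
    also have "(\<Sum>w\<in>W. word_prob w * h w z) = measure (\<mu> i) (cball z (r * \<epsilon>))"
      unfolding h_def using cut by (intro is_cut_measure_cball[symmetric]) auto
    finally have "ennreal (P powr (q - 1)) * (\<Sum>w\<in>Y. ennreal (word_prob w) * ennreal (h w z powr q))
        \<le> ennreal (measure (\<mu> i) (cball z (r * \<epsilon>)) powr q)"
      using p_nonneg YW by (subst ennreal_mult_sum_mult[symmetric]) (auto intro: ennreal_leI)
    then have "indicator B z * (ennreal (P powr (q - 1)) * (\<Sum>w\<in>Y. ennreal (word_prob w) * ennreal (h w z powr q)))
        \<le> indicator B z * ennreal (measure (\<mu> i) (cball z (r * \<epsilon>)) powr q)"
      by (intro mult_left_mono) auto
    then show "ennreal (P powr (q - 1)) * (\<Sum>w\<in>Y. ennreal (word_prob w) * (indicator B z * ennreal (h w z powr q)))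
        \<le> indicator B z * ennreal (measure (\<mu> i) (cball z (r * \<epsilon>)) powr q)"
      by (cases "z \<in> B") simp_all
  qed
  finally show ?thesis
    by (simp add: X_def B_def R_def)
qed

text \<open>The convex counterpart. Pieces that can charge a ball of radius
  \<open>r * \<epsilon>\<close> centred in \<open>cball x r\<close> have centres within
  \<open>(2 + R) * r\<close>, and each of them lies wholly in the ball of radius
  \<open>2 * (1 + R) * r\<close>, whose mass therefore bounds \<open>P\<close>. The scale
  \<open>\<epsilon> / c_min\<close> arises from \<open>c_min * r \<le> word_ratio w\<close>.\<close>

lemma ball_moment_upper_local:
  assumes i: "i \<in> verts G" and cut: "is_cut i r W" and r: "0 < r" and \<epsilon>: "0 < \<epsilon>" "\<epsilon> \<le> 1"
    and q: "1 \<le> q" and m: "\<And>j. j \<in> verts G \<Longrightarrow> ball_moment (\<mu> j) q (\<epsilon> / c_min) \<le> m"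
  shows "(\<integral>\<^sup>+z. indicator (cball x r) z * ennreal (measure (\<mu> i) (cball z (r * \<epsilon>)) powr q) \<partial>lborel)
    \<le> ennreal (measure (\<mu> i) (cball x (2 * (1 + attractor_radius) * r)) powr q) * (ennreal (r ^ DIM(real ^ 'd)) * m)"
proof -
  define R where "R = attractor_radius"
  define Y where "Y = {w \<in> W. dist x (word_map w 0) \<le> (2 + R) * r}"
  define P where "P = (\<Sum>w\<in>Y. word_prob w)"
  define h where "h w z = measure (\<mu> (word_end i w)) (word_map w -` cball z (r * \<epsilon>))" for w z
  define X where "X = ennreal (r ^ DIM(real ^ 'd)) * m"
  have [simp]: "finite Y"
    using is_cut_finite[OF cut] by (simp add: Y_def)
  have W: "set w \<subseteq> arcs G" "word_end i w \<in> verts G" "c_min * r \<le> word_ratio w" "word_ratio w \<le> r"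
    if "w \<in> W" for w
    using is_cut_word[OF cut that] by simp_all
  have YW: "w \<in> W" if "w \<in> Y" for w
    using that by (simp add: Y_def)
  have p_nonneg: "0 \<le> word_prob w" if "w \<in> W" for w
    using word_prob_pos[OF W(1)[OF that]] by simp
  have [measurable]: "h w \<in> borel_measurable borel" if "w \<in> Y" for w
    unfolding h_def using W[OF YW[OF that]] by (intro measurable_word_vimage_cball)
  have R: "1 \<le> R"
    using attractor_radius_ge_one by (simp add: R_def)
  have ratio_R: "word_ratio w * R \<le> r * R" if "w \<in> W" for w
    using W[OF that] R by (intro mult_right_mono) auto
  have r\<epsilon>: "r * \<epsilon> \<le> r"
    using r \<epsilon> by (simp add: mult_left_le)
  have P_nonneg: "0 \<le> P"
    unfolding P_def using p_nonneg YW by (intro sum_nonneg) auto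

  have "(\<integral>\<^sup>+z. indicator (cball x r) z * ennreal (measure (\<mu> i) (cball z (r * \<epsilon>)) powr q) \<partial>lborel)
      \<le> (\<integral>\<^sup>+z. ennreal (P powr (q - 1)) * (\<Sum>w\<in>Y. ennreal (word_prob w) * ennreal (h w z powr q)) \<partial>lborel)"
  proof (rule nn_integral_mono)
    fix z
    show "indicator (cball x r) z * ennreal (measure (\<mu> i) (cball z (r * \<epsilon>)) powr q)
        \<le> ennreal (P powr (q - 1)) * (\<Sum>w\<in>Y. ennreal (word_prob w) * ennreal (h w z powr q))"
    proof (cases "z \<in> cball x r")
      case True
      have "measure (\<mu> i) (cball z (r * \<epsilon>)) = (\<Sum>w\<in>Y. word_prob w * h w z)"
        unfolding h_def
      proof (rule is_cut_measure_cball[OF cut])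
        fix w assume w: "w \<in> W - Y"
        show "measure (\<mu> (word_end i w)) (word_map w -` cball z (r * \<epsilon>)) = 0"
        proof (rule ccontr)
          assume "\<not> ?thesis"
          then have "dist z (word_map w 0) \<le> r * \<epsilon> + word_ratio w * R"
            using w W[of w] dist_word_map_0_le[of w "word_end i w" z "r * \<epsilon>"] by (simp add: R_def)
          moreover have "dist x z \<le> r"
            using True by simp
          ultimately have "dist x (word_map w 0) \<le> (2 + R) * r"
            using dist_triangle[of x "word_map w 0" z] ratio_R[of w] r\<epsilon> w by (simp add: algebra_simps)
          then show False
            using w by (simp add: Y_def)
        qed
      qed (auto simp: Y_def)
      then have "measure (\<mu> i) (cball z (r * \<epsilon>)) powr q = (\<Sum>w\<in>Y. word_prob w * h w z) powr q"
        by simp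
      also have "\<dots> \<le> P powr (q - 1) * (\<Sum>w\<in>Y. word_prob w * h w z powr q)"
        unfolding P_def using p_nonneg YW q by (intro powr_sum_le_sum_powr) (auto simp: h_def)
      finally have "ennreal (measure (\<mu> i) (cball z (r * \<epsilon>)) powr q)
          \<le> ennreal (P powr (q - 1)) * (\<Sum>w\<in>Y. ennreal (word_prob w) * ennreal (h w z powr q))"
        using p_nonneg YW by (subst ennreal_mult_sum_mult[symmetric]) (auto intro: ennreal_leI)
      then show ?thesis
        using True by simp
    qed simp
  qed
  also have "\<dots> = ennreal (P powr (q - 1)) * (\<Sum>w\<in>Y. ennreal (word_prob w) * (\<integral>\<^sup>+z. ennreal (h w z powr q) \<partial>lborel))"
    by (simp add: nn_integral_cmult nn_integral_sum)
  also have "\<dots> \<le> ennreal (P powr (q - 1)) * (\<Sum>w\<in>Y. ennreal (word_prob w) * X)"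
  proof (intro mult_left_mono sum_mono)
    fix w assume "w \<in> Y"
    then have w: "w \<in> W"
      by (rule YW)
    interpret borel_prob_space "\<mu> (word_end i w)"
      using W(2)[OF w] by (rule borel_prob_space_\<mu>)
    have "ball_moment (\<mu> (word_end i w)) q (r * \<epsilon> / word_ratio w) \<le> ball_moment (\<mu> (word_end i w)) q (\<epsilon> / c_min)"
    proof (rule ball_moment_mono)
      have "c_min * r * \<epsilon> \<le> word_ratio w * \<epsilon>"
        using W(3)[OF w] \<epsilon> by (intro mult_right_mono) auto
      then show "r * \<epsilon> / word_ratio w \<le> \<epsilon> / c_min"
        using word_ratio_pos[OF W(1)[OF w]] c_min_pos by (simp add: field_simps)
    qed (use q in auto)
    also have "\<dots> \<le> m"
      using m W(2)[OF w] .
    finally have "ennreal (word_ratio w ^ DIM(real ^ 'd)) * ball_moment (\<mu> (word_end i w)) q (r * \<epsilon> / word_ratio w) \<le> X"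
      unfolding X_def using W(4)[OF w] word_ratio_pos[OF W(1)[OF w]]
      by (intro mult_mono ennreal_leI power_mono) auto
    then show "(\<integral>\<^sup>+z. ennreal (h w z powr q) \<partial>lborel) \<le> X"
      unfolding h_def using W[OF w] by (subst nn_integral_word_vimage_cball)
  qed auto
  also have "\<dots> = ennreal (P powr (q - 1)) * ((\<Sum>w\<in>Y. ennreal (word_prob w)) * X)"
    by (simp only: sum_distrib_right)
  also have "\<dots> = ennreal (P powr (q - 1) * P) * X"
    using p_nonneg YW by (simp add: ennreal_mult' mult.assoc sum_ennreal P_def)
  also have "P powr (q - 1) * P = P powr q"
    using P_nonneg by (rule powr_eq_mult_powr_pred[symmetric])
  also have "ennreal (P powr q) * X \<le> ennreal (measure (\<mu> i) (cball x (2 * (1 + R) * r)) powr q) * X"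
  proof (intro mult_right_mono ennreal_leI powr_mono2)
    have "P = (\<Sum>w\<in>Y. word_prob w * measure (\<mu> (word_end i w)) (word_map w -` cball x (2 * (1 + R) * r)))"
      unfolding P_def
    proof (rule sum.cong[OF refl])
      fix w assume "w \<in> Y"
      then have "measure (\<mu> (word_end i w)) (word_map w -` cball x (2 * (1 + R) * r)) = 1"
        using W[OF YW[OF \<open>w \<in> Y\<close>]] ratio_R[OF YW[OF \<open>w \<in> Y\<close>]]
        by (intro measure_word_vimage_eq_1) (auto simp: Y_def R_def algebra_simps)
      then show "word_prob w = word_prob w * measure (\<mu> (word_end i w)) (word_map w -` cball x (2 * (1 + R) * r))"
        by simp
    qed
    also have "\<dots> \<le> (\<Sum>w\<in>W. word_prob w * measure (\<mu> (word_end i w)) (word_map w -` cball x (2 * (1 + R) * r)))"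
      using p_nonneg YW is_cut_finite[OF cut] by (intro sum_mono2) auto
    also have "\<dots> = measure (\<mu> i) (cball x (2 * (1 + R) * r))"
      using cut by (intro is_cut_measure_cball[symmetric]) auto
    finally show "P \<le> measure (\<mu> i) (cball x (2 * (1 + R) * r))" .
  qed (use q P_nonneg in auto)
  finally show ?thesis
    by (simp add: X_def R_def)
qed

section \<open>Real-valued moments and their growth exponent\<close>

definition moment :: "nat \<Rightarrow> real \<Rightarrow> real \<Rightarrow> real" where
  "moment i q \<delta> = enn2real (ball_moment (\<mu> i) q \<delta>)"

lemma ball_moment_finite:
  assumes i: "i \<in> verts G" and q: "0 \<le> q"
  shows "ball_moment (\<mu> i) q \<delta> < \<infinity>"
proof -
  interpret borel_prob_space "\<mu> i"
    using i by (rule borel_prob_space_\<mu>)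
  have "ball_moment (\<mu> i) q \<delta> \<le> (\<integral>\<^sup>+x. indicator (cball (0 :: real ^ 'd) (\<delta> + attractor_radius)) x \<partial>lborel)"
    unfolding ball_moment_def
  proof (rule nn_integral_mono)
    fix x :: "real ^ 'd"
    show "ennreal (measure (\<mu> i) (cball x \<delta>) powr q) \<le> indicator (cball 0 (\<delta> + attractor_radius)) x"
    \<comment> \<open>Away from the carrying ball the integrand vanishes, for \<open>q = 0\<close>
      too because \<open>0 powr 0 = 0\<close>.\<close>
    proof (cases "measure (\<mu> i) (cball x \<delta>) = 0")
      case False
      then have "dist x 0 \<le> \<delta> + attractor_radius"
        using dist_word_map_0_le[of "[]" i x \<delta>] i by simp
      moreover have "measure (\<mu> i) (cball x \<delta>) powr q \<le> 1"
        using q powr_mono2[of q "measure (\<mu> i) (cball x \<delta>)" 1] by simp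
      ultimately show ?thesis
        by simp
    qed simp
  qed
  also have "\<dots> < \<infinity>"
    using emeasure_lborel_cball_finite by simp
  finally show ?thesis .
qed

lemma ennreal_moment: "i \<in> verts G \<Longrightarrow> 0 \<le> q \<Longrightarrow> ennreal (moment i q \<delta>) = ball_moment (\<mu> i) q \<delta>"
  using ball_moment_finite unfolding moment_def by (intro ennreal_enn2real) auto

lemma moment_nonneg: "0 \<le> moment i q \<delta>"
  by (simp add: moment_def)

lemma moment_mono:
  assumes "i \<in> verts G" "0 \<le> q" "\<delta> \<le> \<delta>'"
  shows "moment i q \<delta> \<le> moment i q \<delta>'"
proof -
  interpret borel_prob_space "\<mu> i"
    using assms(1) by (rule borel_prob_space_\<mu>)
  have "ennreal (moment i q \<delta>) \<le> ennreal (moment i q \<delta>')"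
    using assms by (simp only: ennreal_moment ball_moment_mono)
  then show ?thesis
    using moment_nonneg by simp
qed

lemma moment_doubling:
  assumes i: "i \<in> verts G" and q: "0 \<le> q" and K: "0 < K"
  shows "\<exists>C>0. \<forall>\<delta>>0. moment i q (K * \<delta>) \<le> C * moment i q \<delta>"
proof -
  interpret borel_prob_space "\<mu> i"
    using i by (rule borel_prob_space_\<mu>)
  obtain C where C: "C > 0" "\<And>\<delta>. 0 < \<delta> \<Longrightarrow> ball_moment (\<mu> i) q (K * \<delta>) \<le> ennreal C * ball_moment (\<mu> i) q \<delta>"
    using ball_moment_doubling[OF q K] by blast
  have "moment i q (K * \<delta>) \<le> C * moment i q \<delta>" if "0 < \<delta>" for \<delta>
  proof -
    have "ennreal (moment i q (K * \<delta>)) \<le> ennreal (C * moment i q \<delta>)"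
      using C(2)[OF that] C(1) i q by (simp add: ennreal_moment ennreal_mult moment_nonneg)
    then show ?thesis
      using moment_nonneg C(1) by simp
  qed
  then show ?thesis
    using C(1) by blast
qed

text \<open>At a radius so large that every ball centred in the unit ball has full mass, positivity
  is evident. Doubling with the factor \<open>r / \<delta>\<close> brings it down to
  \<delta>.\<close>

lemma moment_pos:
  assumes i: "i \<in> verts G" and q: "0 \<le> q" and \<delta>: "0 < \<delta>"
  shows "0 < moment i q \<delta>"
proof -
  interpret borel_prob_space "\<mu> i"
    using i by (rule borel_prob_space_\<mu>)
  define r where "r = attractor_radius + 1"
  have r: "0 < r / \<delta>"
    using attractor_radius_ge_one \<delta> by (simp add: r_def)
  have "0 < ennreal (cball_volume TYPE(real ^ 'd) 1)"
    by (simp add: cball_volume_pos)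
  also have "\<dots> = (\<integral>\<^sup>+x. indicator (cball (0 :: real ^ 'd) 1) x \<partial>lborel)"
    by (simp add: emeasure_lborel_cball_eq)
  also have "\<dots> \<le> ball_moment (\<mu> i) q r"
    unfolding ball_moment_def
  proof (rule nn_integral_mono)
    fix x :: "real ^ 'd"
    show "indicator (cball 0 1) x \<le> ennreal (measure (\<mu> i) (cball x r) powr q)"
    proof (cases "x \<in> cball 0 1")
      case True
      then have "measure (\<mu> i) (cball x r) = 1"
        using measure_word_vimage_eq_1[of "[]" i x r] i by (simp add: r_def)
      then show ?thesis
        using True by simp
    qed simp
  qed
  also have "\<dots> = ennreal (moment i q r)"
    using i q by (simp add: ennreal_moment)
  finally have "0 < moment i q r"
    by simp
  moreover obtain C where "C > 0" "\<And>\<delta>'. 0 < \<delta>' \<Longrightarrow> moment i q (r / \<delta> * \<delta>') \<le> C * moment i q \<delta>'"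
    using moment_doubling[OF i q r] by blast
  from this(1) this(2)[OF \<delta>] have "moment i q r \<le> C * moment i q \<delta>" "C > 0"
    using \<delta> by auto
  ultimately have "0 < C * moment i q \<delta>"
    by linarith
  then show ?thesis
    using \<open>C > 0\<close> by (rule zero_less_mult_pos)
qed

lemma moment_comparable:
  assumes "i \<in> verts G" "j \<in> verts G" and q: "0 \<le> q"
  shows "\<exists>C>0. \<forall>\<delta>>0. moment j q \<delta> \<le> C * moment i q \<delta>"
proof -
  obtain \<kappa> where \<kappa>: "\<kappa> > 0" "\<And>\<delta>. 0 < \<delta> \<Longrightarrow> ennreal \<kappa> * ball_moment (\<mu> j) q \<delta> \<le> ball_moment (\<mu> i) q \<delta>"
    using ball_moment_comparable[OF assms] by blast
  have "moment j q \<delta> \<le> 1 / \<kappa> * moment i q \<delta>" if "0 < \<delta>" for \<delta>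
  proof -
    have "ennreal (\<kappa> * moment j q \<delta>) \<le> ennreal (moment i q \<delta>)"
      using \<kappa>(2)[OF that] \<kappa>(1) assms by (simp add: ennreal_moment ennreal_mult moment_nonneg)
    then have "\<kappa> * moment j q \<delta> \<le> moment i q \<delta>"
      using moment_nonneg by simp
    then show ?thesis
      using \<kappa>(1) by (simp add: field_simps)
  qed
  then show ?thesis
    using \<kappa>(1) by (intro exI[of _ "1 / \<kappa>"]) auto
qed

text \<open>The sum of the constants over the finitely many vertices serves all of them, as both
  inequalities survive enlarging the constant.\<close>

lemma moment_comparable_uniform:
  assumes i: "i \<in> verts G" and q: "0 \<le> q"
  shows "\<exists>C>0. \<forall>j\<in>verts G. \<forall>\<delta>>0. moment j q \<delta> \<le> C * moment i q \<delta>"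
    and "\<exists>C>0. \<forall>j\<in>verts G. \<forall>\<delta>>0. moment i q \<delta> \<le> C * moment j q \<delta>"
proof -
  have uniform: "\<exists>C>0. \<forall>j\<in>verts G. P j C"
    if ex: "\<And>j. j \<in> verts G \<Longrightarrow> \<exists>C>0. P j C" and up: "\<And>j C C'. P j C \<Longrightarrow> C \<le> C' \<Longrightarrow> P j C'"
    for P :: "nat \<Rightarrow> real \<Rightarrow> bool"
  proof -
    obtain C where C: "\<And>j. j \<in> verts G \<Longrightarrow> C j > 0 \<and> P j (C j)"
      using ex by metis
    have le: "C j \<le> (\<Sum>j\<in>verts G. C j)" if "j \<in> verts G" for j
      using C that by (intro member_le_sum) (auto intro: less_imp_le)
    then have "0 < (\<Sum>j\<in>verts G. C j)"
      using C[OF i] le[OF i] by linarith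
    then show ?thesis
      using C le up by blast
  qed
  have enlarge: "\<forall>\<delta>>0. x \<delta> \<le> C' * y \<delta>"
    if "\<forall>\<delta>>0. x \<delta> \<le> C * y \<delta>" "C \<le> C'" "\<And>\<delta>. 0 \<le> y \<delta>" for x y :: "real \<Rightarrow> real" and C C'
    using that by (meson mult_right_mono order_trans)
  show "\<exists>C>0. \<forall>j\<in>verts G. \<forall>\<delta>>0. moment j q \<delta> \<le> C * moment i q \<delta>"
    by (rule uniform[of "\<lambda>j C. \<forall>\<delta>>0. moment j q \<delta> \<le> C * moment i q \<delta>"])
       (use moment_comparable[OF i _ q] enlarge moment_nonneg in blast)+
  show "\<exists>C>0. \<forall>j\<in>verts G. \<forall>\<delta>>0. moment i q \<delta> \<le> C * moment j q \<delta>"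
    by (rule uniform[of "\<lambda>j C. \<forall>\<delta>>0. moment i q \<delta> \<le> C * moment j q \<delta>"])
       (use moment_comparable[OF _ i q] enlarge moment_nonneg in blast)+
qed

lemma moment_supermultiplicative:
  assumes i: "i \<in> verts G" and q: "0 \<le> q" "q \<le> 1"
  shows "\<exists>k>0. \<forall>r \<epsilon>. 0 < r \<longrightarrow> r \<le> 1 \<longrightarrow> 0 < \<epsilon> \<longrightarrow> \<epsilon> \<le> 1 \<longrightarrow>
    k * (moment i q r * moment i q \<epsilon>) \<le> moment i q (r * \<epsilon>)"
proof -
  interpret borel_prob_space "\<mu> i"
    using i by (rule borel_prob_space_\<mu>)
  obtain C where C: "C > 0" "\<And>j \<delta>. j \<in> verts G \<Longrightarrow> 0 < \<delta> \<Longrightarrow> moment i q \<delta> \<le> C * moment j q \<delta>"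
    using moment_comparable_uniform(2)[OF i q(1)] by blast
  define K where "K = 2 * (1 + attractor_radius)"
  have K: "0 < K"
    using attractor_radius_ge_one by (simp add: K_def)
  define V where "V = cball_volume TYPE(real ^ 'd) K"
  have V: "0 < V"
    using K by (simp add: V_def cball_volume_pos)
  \<comment> \<open>\<open>C\<close> replaces the end vertices of the words by \<open>i\<close>,
    \<open>V\<close> is the volume left over from averaging, and \<open>c_min\<close> bounds the
    word ratios below; the factor \<open>r ^ DIM(real ^ 'd)\<close> cancels.\<close>
  define k where "k = c_min ^ DIM(real ^ 'd) / (C * V)"
  have "k * (moment i q r * moment i q \<epsilon>) \<le> moment i q (r * \<epsilon>)"
    if r: "0 < r" "r \<le> 1" and \<epsilon>: "0 < \<epsilon>" "\<epsilon> \<le> 1" for r \<epsilon>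
  proof -
    define m where "m = moment i q \<epsilon> / C"
    have m: "0 \<le> m"
      using C moment_nonneg by (simp add: m_def)
    have cr: "0 \<le> (c_min * r) ^ DIM(real ^ 'd)"
      using r c_min_pos by simp
    have m_le: "ennreal m \<le> ball_moment (\<mu> j) q \<epsilon>" if j: "j \<in> verts G" for j
    proof -
      have "m \<le> moment j q \<epsilon>"
        using C(2)[OF j \<epsilon>(1)] C(1) by (simp add: m_def field_simps)
      then show ?thesis
        using j q by (simp flip: ennreal_moment add: ennreal_leI)
    qed
    obtain W where W: "is_cut i r W"
      using is_cut_exists[OF i r] by blast
    have "ennreal (moment i q r * ((c_min * r) ^ DIM(real ^ 'd) * m))
        = ball_moment (\<mu> i) q r * (ennreal ((c_min * r) ^ DIM(real ^ 'd)) * ennreal m)"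
      using i q m cr by (simp add: ennreal_mult moment_nonneg ennreal_moment)
    also have "\<dots> = (\<integral>\<^sup>+x. ennreal (measure (\<mu> i) (cball x r) powr q)
        * (ennreal ((c_min * r) ^ DIM(real ^ 'd)) * ennreal m) \<partial>lborel)"
      unfolding ball_moment_def by (intro nn_integral_multc[symmetric]) measurable
    also have "\<dots> \<le> (\<integral>\<^sup>+x. (\<integral>\<^sup>+z. indicator (cball x (K * r)) z
        * ennreal (measure (\<mu> i) (cball z (r * \<epsilon>)) powr q) \<partial>lborel) \<partial>lborel)"
      unfolding K_def using ball_moment_lower_local[OF i W r(1) \<epsilon> q m_le] by (intro nn_integral_mono) simp
    also have "\<dots> = ennreal (cball_volume TYPE(real ^ 'd) (K * r)) * ball_moment (\<mu> i) q (r * \<epsilon>)"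
      unfolding ball_moment_def
      using K r by (intro nn_integral_ball_average sigma_finite_lborel) auto
    also have "\<dots> = ennreal (r ^ DIM(real ^ 'd) * V * moment i q (r * \<epsilon>))"
      using i q V r by (simp add: ennreal_mult moment_nonneg ennreal_moment V_def mult.commute[of K] cball_volume_mult)
    finally have "moment i q r * ((c_min * r) ^ DIM(real ^ 'd) * m) \<le> r ^ DIM(real ^ 'd) * V * moment i q (r * \<epsilon>)"
      using V r moment_nonneg by (subst (asm) ennreal_le_iff) auto
    then have "r ^ DIM(real ^ 'd) * (c_min ^ DIM(real ^ 'd) * (moment i q r * m))
        \<le> r ^ DIM(real ^ 'd) * (V * moment i q (r * \<epsilon>))"
      by (simp add: power_mult_distrib mult_ac)
    then have "c_min ^ DIM(real ^ 'd) * (moment i q r * m) \<le> V * moment i q (r * \<epsilon>)"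
      using r by (subst (asm) mult_le_cancel_left_pos) auto
    then show ?thesis
      using V C(1) by (simp add: k_def m_def field_simps)
  qed
  moreover have "0 < k"
    using c_min_pos C V by (simp add: k_def)
  ultimately show ?thesis
    by blast
qed

lemma moment_submultiplicative:
  assumes i: "i \<in> verts G" and q: "1 \<le> q"
  shows "\<exists>k>0. \<forall>r \<epsilon>. 0 < r \<longrightarrow> r \<le> 1 \<longrightarrow> 0 < \<epsilon> \<longrightarrow> \<epsilon> \<le> 1 \<longrightarrow>
    moment i q (r * \<epsilon>) \<le> k * (moment i q r * moment i q \<epsilon>)"
proof -
  interpret borel_prob_space "\<mu> i"
    using i by (rule borel_prob_space_\<mu>)
  have q0: "0 \<le> q"
    using q by simp
  obtain C where C: "C > 0" "\<And>j \<delta>. j \<in> verts G \<Longrightarrow> 0 < \<delta> \<Longrightarrow> moment j q \<delta> \<le> C * moment i q \<delta>"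
    using moment_comparable_uniform(1)[OF i q0] by blast
  define K where "K = 2 * (1 + attractor_radius)"
  have K: "0 < K"
    using attractor_radius_ge_one by (simp add: K_def)
  obtain C1 where C1: "C1 > 0" "\<And>\<delta>. 0 < \<delta> \<Longrightarrow> moment i q (K * \<delta>) \<le> C1 * moment i q \<delta>"
    using moment_doubling[OF i q0 K] by blast
  have "0 < 1 / c_min"
    using c_min_pos by simp
  then obtain C2 where C2: "C2 > 0" "\<And>\<delta>. 0 < \<delta> \<Longrightarrow> moment i q (1 / c_min * \<delta>) \<le> C2 * moment i q \<delta>"
    using moment_doubling[OF i q0] by blast
  define V where "V = cball_volume TYPE(real ^ 'd) 1"
  have V: "0 < V"
    by (simp add: V_def cball_volume_pos)
  \<comment> \<open>\<open>C1\<close> undoes the enlargement of \<open>r\<close> to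
    \<open>K * r\<close>, \<open>C2\<close> that of \<epsilon> to \<open>\<epsilon> / c_min\<close>,
    and \<open>C\<close> replaces the end vertices of the words by \<open>i\<close>.\<close>
  define k where "k = C1 * (C * C2) / V"
  have "moment i q (r * \<epsilon>) \<le> k * (moment i q r * moment i q \<epsilon>)"
    if r: "0 < r" "r \<le> 1" and \<epsilon>: "0 < \<epsilon>" "\<epsilon> \<le> 1" for r \<epsilon>
  proof -
    define m where "m = C * C2 * moment i q \<epsilon>"
    have m: "0 \<le> m"
      using C C2 moment_nonneg by (simp add: m_def)
    have m_le: "ball_moment (\<mu> j) q (\<epsilon> / c_min) \<le> ennreal m" if j: "j \<in> verts G" for j
    proof -
      have "moment j q (\<epsilon> / c_min) \<le> C * moment i q (1 / c_min * \<epsilon>)"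
        using C(2)[OF j, of "\<epsilon> / c_min"] \<epsilon> c_min_pos by simp
      also have "\<dots> \<le> C * (C2 * moment i q \<epsilon>)"
        using C2(2)[OF \<epsilon>(1)] C(1) by (intro mult_left_mono) auto
      finally show ?thesis
        using j q0 by (simp flip: ennreal_moment add: ennreal_leI m_def mult.assoc)
    qed
    obtain W where W: "is_cut i r W"
      using is_cut_exists[OF i r] by blast
    have "ennreal (r ^ DIM(real ^ 'd) * V * moment i q (r * \<epsilon>))
        = ennreal (cball_volume TYPE(real ^ 'd) (r * 1)) * ball_moment (\<mu> i) q (r * \<epsilon>)"
      unfolding cball_volume_mult V_def[symmetric]
      using i q0 V r by (simp add: ennreal_mult moment_nonneg ennreal_moment)
    also have "\<dots> = (\<integral>\<^sup>+x. (\<integral>\<^sup>+z. indicator (cball x (r * 1)) z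
        * ennreal (measure (\<mu> i) (cball z (r * \<epsilon>)) powr q) \<partial>lborel) \<partial>lborel)"
      unfolding ball_moment_def
      using r by (intro nn_integral_ball_average[symmetric] sigma_finite_lborel) auto
    also have "\<dots> \<le> (\<integral>\<^sup>+x. ennreal (measure (\<mu> i) (cball x (K * r)) powr q)
        * (ennreal (r ^ DIM(real ^ 'd)) * ennreal m) \<partial>lborel)"
      unfolding K_def using ball_moment_upper_local[OF i W r(1) \<epsilon> q m_le] by (intro nn_integral_mono) simp
    also have "\<dots> = ball_moment (\<mu> i) q (K * r) * (ennreal (r ^ DIM(real ^ 'd)) * ennreal m)"
      unfolding ball_moment_def by (intro nn_integral_multc) measurable
    also have "\<dots> = ennreal (moment i q (K * r) * (r ^ DIM(real ^ 'd) * m))"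
      using i q0 m r by (simp add: ennreal_mult moment_nonneg ennreal_moment)
    finally have "r ^ DIM(real ^ 'd) * V * moment i q (r * \<epsilon>) \<le> moment i q (K * r) * (r ^ DIM(real ^ 'd) * m)"
      using m r moment_nonneg by (subst (asm) ennreal_le_iff) auto
    then have "r ^ DIM(real ^ 'd) * (V * moment i q (r * \<epsilon>)) \<le> r ^ DIM(real ^ 'd) * (moment i q (K * r) * m)"
      by (simp add: mult_ac)
    then have "V * moment i q (r * \<epsilon>) \<le> moment i q (K * r) * m"
      using r by (subst (asm) mult_le_cancel_left_pos) auto
    also have "\<dots> \<le> (C1 * moment i q r) * m"
      using C1(2)[OF r(1)] m by (intro mult_right_mono) auto
    finally have "V * moment i q (r * \<epsilon>) \<le> V * (k * (moment i q r * moment i q \<epsilon>))"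
      using V by (simp add: k_def m_def mult_ac)
    then show ?thesis
      using V by (subst (asm) mult_le_cancel_left_pos) auto
  qed
  moreover have "0 < k"
    using C C1 C2 V by (simp add: k_def)
  ultimately show ?thesis
    by blast
qed

lemma moment_exponent:
  assumes i: "i \<in> verts G" and q: "0 \<le> q"
  shows "\<exists>L. ((\<lambda>\<delta>. ereal (ln (moment i q \<delta>) / (- ln \<delta>))) \<longlongrightarrow> L) (at_right 0)"
proof (cases "q \<le> 1")
  case True
  obtain k where "k > 0" "\<And>r \<epsilon>. 0 < r \<Longrightarrow> r \<le> 1 \<Longrightarrow> 0 < \<epsilon> \<Longrightarrow> \<epsilon> \<le> 1 \<Longrightarrow>
      k * (moment i q r * moment i q \<epsilon>) \<le> moment i q (r * \<epsilon>)"
    using moment_supermultiplicative[OF i q True] by blast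
  then show ?thesis
    using supermultiplicative_exponent[of "moment i q" k] moment_pos[OF i q] moment_mono[OF i q] by blast
next
  case False
  then have "1 \<le> q"
    by simp
  then obtain k where "k > 0" "\<And>r \<epsilon>. 0 < r \<Longrightarrow> r \<le> 1 \<Longrightarrow> 0 < \<epsilon> \<Longrightarrow> \<epsilon> \<le> 1 \<Longrightarrow>
      moment i q (r * \<epsilon>) \<le> k * (moment i q r * moment i q \<epsilon>)"
    using moment_submultiplicative[OF i] by blast
  then show ?thesis
    using submultiplicative_exponent[of "moment i q" k] moment_pos[OF i q] moment_mono[OF i q] by blast
qed

section \<open>Return to the integral in the spectrum\<close>

lemma halving_count_logarithmic:
  "\<exists>A>0. \<forall>\<delta>. 0 < \<delta> \<longrightarrow> \<delta> < 1 \<longrightarrow> (\<exists>n. real (n + 2) \<le> A * (1 - ln \<delta>) \<and>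
    (\<forall>i\<in>verts G. \<forall>x. 0 < measure (\<mu> i) (cball x \<delta>) \<longrightarrow> 1 \<le> 2 ^ n * measure (\<mu> i) (cball x (2 * \<delta>))))"
proof -
  \<comment> \<open>Following \<open>a\<close> arcs shrinks lengths by at least a factor
    \<open>e\<close>, and \<open>b\<close> doublings outweigh the mass lost along one arc.\<close>
  obtain a where a: "c_max ^ a < exp (- 1)"
    using real_arch_pow_inv[of "exp (- 1)" c_max] c_max_less_one by auto
  obtain b where b: "1 / p_min < 2 ^ b"
    using real_arch_pow[of 2 "1 / p_min"] by auto
  define \<rho> where "\<rho> = 2 * attractor_radius"
  have \<rho>: "2 \<le> \<rho>"
    using attractor_radius_ge_one by (simp add: \<rho>_def)
  \<comment> \<open>The quantity \<open>1 - ln \<delta>\<close>, unlike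
    \<open>- ln \<delta>\<close>, stays above 1 on the whole interval and so absorbs all additive
    constants into \<open>A\<close>.\<close>
  define A where "A = real (b * a) * (ln \<rho> + 1) + 2"
  have ln\<rho>: "0 \<le> ln \<rho>"
    using \<rho> by simp
  have "\<exists>n. real (n + 2) \<le> A * (1 - ln \<delta>) \<and>
      (\<forall>i\<in>verts G. \<forall>x. 0 < measure (\<mu> i) (cball x \<delta>) \<longrightarrow> 1 \<le> 2 ^ n * measure (\<mu> i) (cball x (2 * \<delta>)))"
    if \<delta>: "0 < \<delta>" "\<delta> < 1" for \<delta>
  proof -
    have ln\<delta>: "0 \<le> - ln \<delta>"
      using \<delta> by simp
    \<comment> \<open>Just large enough for \<open>\<rho> * exp (- t) \<le> \<delta>\<close>, so
      that the enlargement left after \<open>a * t\<close> arcs fits between the radii \<delta> and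
      \<open>2 * \<delta>\<close>.\<close>
    define t where "t = nat \<lceil>ln \<rho> - ln \<delta>\<rceil>"
    have t: "ln \<rho> - ln \<delta> \<le> real t" "real t \<le> ln \<rho> - ln \<delta> + 1"
      using ln\<rho> ln\<delta> unfolding t_def by linarith+
    define n where "n = b * (a * t)"
    have "real (n + 2) = real (b * a) * real t + 2"
      by (simp add: n_def)
    also have "\<dots> \<le> real (b * a) * (ln \<rho> + 1 + (- ln \<delta>)) + 2"
      using t by (intro add_right_mono mult_left_mono) auto
    also have "\<dots> \<le> real (b * a) * ((ln \<rho> + 1) * (1 - ln \<delta>)) + 2 * (1 - ln \<delta>)"
    proof (intro add_mono mult_left_mono)
      have "(ln \<rho> + 1) * (1 - ln \<delta>) = ln \<rho> + 1 + (- ln \<delta>) + ln \<rho> * (- ln \<delta>)"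
        by (simp add: algebra_simps)
      then show "ln \<rho> + 1 + (- ln \<delta>) \<le> (ln \<rho> + 1) * (1 - ln \<delta>)"
        using mult_nonneg_nonneg[OF ln\<rho> ln\<delta>] by linarith
    qed (use ln\<delta> in auto)
    also have "\<dots> = A * (1 - ln \<delta>)"
      by (simp add: A_def algebra_simps)
    finally have n_le: "real (n + 2) \<le> A * (1 - ln \<delta>)" .
    have "c_max ^ (a * t) = (c_max ^ a) ^ t"
      by (rule power_mult)
    also have "\<dots> \<le> exp (- 1) ^ t"
      using a c_max_pos by (intro power_mono) auto
    also have "\<dots> = exp (- real t)"
      by (simp add: exp_of_nat_mult[symmetric])
    also have "\<dots> \<le> exp (ln \<delta> - ln \<rho>)"
      using t by simp
    also have "\<dots> = \<delta> / \<rho>"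
      using \<delta> \<rho> by (simp add: exp_diff)
    finally have small: "\<rho> * c_max ^ (a * t) \<le> \<delta>"
      using \<rho> by (simp add: field_simps)
    have "1 \<le> 2 ^ n * measure (\<mu> i) (cball x (2 * \<delta>))"
      if i: "i \<in> verts G" and pos: "0 < measure (\<mu> i) (cball x \<delta>)" for i x
    proof -
      interpret borel_prob_space "\<mu> i"
        using i by (rule borel_prob_space_\<mu>)
      have "1 \<le> (2 ^ b * p_min) ^ (a * t)"
        using b p_min_pos by (intro one_le_power) (simp add: field_simps)
      also have "\<dots> = 2 ^ n * p_min ^ (a * t)"
        by (simp add: n_def power_mult_distrib power_mult)
      also have "p_min ^ (a * t) \<le> measure (\<mu> i) (cball x (\<delta> + \<rho> * c_max ^ (a * t)))"
        unfolding \<rho>_def using i pos by (rule measure_cball_lower_bound)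
      also have "\<dots> \<le> measure (\<mu> i) (cball x (2 * \<delta>))"
        using small by (intro measure_cball_mono subset_cball) simp
      finally show ?thesis
        by simp
    qed
    then show ?thesis
      using n_le by blast
  qed
  moreover have "0 < A"
    using ln\<rho> unfolding A_def by (intro add_nonneg_pos) auto
  ultimately show ?thesis
    by blast
qed

lemma Lq_integral_comparable_self:
  assumes i: "i \<in> verts G" and q: "0 \<le> q"
  shows "\<exists>A>0. \<forall>\<delta>. 0 < \<delta> \<longrightarrow> \<delta> < 1 \<longrightarrow>
    \<delta> ^ DIM(real ^ 'd) * Lq_integral (\<mu> i) q \<delta> \<le> A * moment i q \<delta> \<and>
    moment i q \<delta> \<le> A * (1 - ln \<delta>) ^ DIM(real ^ 'd) * (\<delta> ^ DIM(real ^ 'd) * Lq_integral (\<mu> i) q \<delta>)"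
proof -
  interpret borel_prob_space "\<mu> i"
    using i by (rule borel_prob_space_\<mu>)
  define J where "J \<delta> = (\<integral>\<^sup>+y. ennreal (measure (\<mu> i) (cball y \<delta>) powr (q - 1)) \<partial>\<mu> i)" for \<delta>
  define I where "I \<delta> = Lq_integral (\<mu> i) q \<delta>" for \<delta>
  have I_nonneg: "0 \<le> I \<delta>" for \<delta>
    by (simp add: I_def Lq_integral_eq_nn_integral)
  define V where "V = cball_volume TYPE(real ^ 'd)"
  have V_pos: "0 < V r" if "0 < r" for r
    using that by (simp add: V_def cball_volume_pos)
  have V_scale: "V (s * r) = s ^ DIM(real ^ 'd) * V r" for s r
    unfolding V_def by (rule cball_volume_mult)
  \<comment> \<open>Finiteness of the moment forces \<open>J \<delta>\<close> to be finite; this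
    makes the real integral a faithful copy of it.\<close>
  have from_J: "ennreal (I \<delta>) = J \<delta> \<and> V s * I \<delta> \<le> moment i q s'"
    if "ennreal (V s) * J \<delta> \<le> ball_moment (\<mu> i) q s'" "0 < s" for \<delta> s s'
  proof -
    have "ennreal (V s) * J \<delta> < \<infinity>"
      using that ball_moment_finite[OF i q] le_less_trans by blast
    then have "J \<delta> < \<infinity>"
      using V_pos[OF that(2)] by (auto simp: ennreal_mult_less_top)
    then have *: "ennreal (I \<delta>) = J \<delta>"
      unfolding I_def Lq_integral_eq_nn_integral J_def[symmetric] by (intro ennreal_enn2real) auto
    have "ennreal (V s * I \<delta>) \<le> ennreal (moment i q s')"
      using that V_pos[OF that(2)] i q by (simp add: ennreal_mult I_nonneg * ennreal_moment)
    then show ?thesis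
      using * moment_nonneg by simp
  qed
  show ?thesis
  proof (cases "q \<le> 1")
    case True
    obtain B where B: "B > 0" "\<And>\<delta>. 0 < \<delta> \<Longrightarrow> \<delta> < 1 \<Longrightarrow> \<exists>n. real (n + 2) \<le> B * (1 - ln \<delta>) \<and>
        (\<forall>x. 0 < measure (\<mu> i) (cball x \<delta>) \<longrightarrow> 1 \<le> 2 ^ n * measure (\<mu> i) (cball x (2 * \<delta>)))"
      using halving_count_logarithmic i by metis
    define A1 where "A1 = 1 / V (1 / 3)"
    define A2 where "A2 = 2 * (B ^ DIM(real ^ 'd) * V 1)"
    have A: "0 < A1" "0 < A2"
      using V_pos B(1) by (auto simp: A1_def A2_def)
    have bounds: "\<delta> ^ DIM(real ^ 'd) * I \<delta> \<le> A1 * moment i q \<delta>"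
      "moment i q \<delta> \<le> A2 * (1 - ln \<delta>) ^ DIM(real ^ 'd) * (\<delta> ^ DIM(real ^ 'd) * I \<delta>)"
      if \<delta>: "0 < \<delta>" "\<delta> < 1" for \<delta>
    proof -
      \<comment> \<open>The averaging radius \<open>\<delta> / 3\<close> makes the balls in the
        integrand have radius exactly \<delta>, and the moment at \<open>2 * (\<delta> / 3)\<close>
        is below that at \<delta> by monotonicity.\<close>
      have "ennreal (V (\<delta> / 3)) * J \<delta> \<le> ball_moment (\<mu> i) q (2 * (\<delta> / 3))"
        using le_ball_moment_of_le_one[OF q True, of "\<delta> / 3"] \<delta> by (simp add: V_def J_def)
      from from_J[OF this] have *: "ennreal (I \<delta>) = J \<delta>" "V (\<delta> / 3) * I \<delta> \<le> moment i q (2 * (\<delta> / 3))"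
        using \<delta> by auto
      have "\<delta> ^ DIM(real ^ 'd) * V (1 / 3) * I \<delta> = V (\<delta> / 3) * I \<delta>"
        using V_scale[of \<delta> "1 / 3"] by simp
      also have "\<dots> \<le> moment i q \<delta>"
        using *(2) moment_mono[OF i q, of "2 * (\<delta> / 3)" \<delta>] \<delta> by simp
      finally show "\<delta> ^ DIM(real ^ 'd) * I \<delta> \<le> A1 * moment i q \<delta>"
        using V_pos[of "1 / 3"] by (simp add: A1_def field_simps)
      obtain n where n: "real (n + 2) \<le> B * (1 - ln \<delta>)"
        "\<And>x. 0 < measure (\<mu> i) (cball x \<delta>) \<Longrightarrow> 1 \<le> 2 ^ n * measure (\<mu> i) (cball x (2 * \<delta>))"
        using B(2)[OF \<delta>] by blast
      have V': "0 \<le> V (real (n + 2) * \<delta>)"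
        using V_pos[of "real (n + 2) * \<delta>"] \<delta> by simp
      have "ball_moment (\<mu> i) q \<delta> \<le> ennreal (2 * V (real (n + 2) * \<delta>)) * J \<delta>"
        unfolding V_def J_def using ball_moment_le_of_le_one[OF q True \<delta>(1) n(2)] .
      then have "ennreal (moment i q \<delta>) \<le> ennreal (2 * V (real (n + 2) * \<delta>) * I \<delta>)"
        using i q V' by (simp add: ennreal_moment ennreal_mult I_nonneg *(1))
      then have "moment i q \<delta> \<le> 2 * V (real (n + 2) * \<delta>) * I \<delta>"
        using V' I_nonneg by (subst (asm) ennreal_le_iff) auto
      also have "V (real (n + 2) * \<delta>) = real (n + 2) ^ DIM(real ^ 'd) * (\<delta> ^ DIM(real ^ 'd) * V 1)"
        using V_scale[of "real (n + 2)" \<delta>] V_scale[of \<delta> 1] by simp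
      also have "2 * \<dots> * I \<delta> \<le> 2 * ((B * (1 - ln \<delta>)) ^ DIM(real ^ 'd) * (\<delta> ^ DIM(real ^ 'd) * V 1)) * I \<delta>"
        using n(1) \<delta> V_pos[of 1] I_nonneg
        by (intro mult_right_mono mult_left_mono power_mono mult_nonneg_nonneg) auto
      also have "\<dots> = A2 * (1 - ln \<delta>) ^ DIM(real ^ 'd) * (\<delta> ^ DIM(real ^ 'd) * I \<delta>)"
        by (simp add: A2_def power_mult_distrib mult_ac)
      finally show "moment i q \<delta> \<le> A2 * (1 - ln \<delta>) ^ DIM(real ^ 'd) * (\<delta> ^ DIM(real ^ 'd) * I \<delta>)" .
    qed
    show ?thesis
    proof (intro exI[of _ "max A1 A2"] conjI allI impI)
      fix \<delta> :: real assume \<delta>: "0 < \<delta>" "\<delta> < 1"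
      show "\<delta> ^ DIM(real ^ 'd) * Lq_integral (\<mu> i) q \<delta> \<le> max A1 A2 * moment i q \<delta>"
        using bounds(1)[OF \<delta>] mult_right_mono[OF max.cobounded1[of A1 A2] moment_nonneg[of i q \<delta>]]
        unfolding I_def by (rule order_trans)
      have "ln \<delta> < 0"
        using \<delta> by simp
      then have "0 \<le> (1 - ln \<delta>) ^ DIM(real ^ 'd)"
        by (intro zero_le_power) linarith
      then have "A2 * (1 - ln \<delta>) ^ DIM(real ^ 'd) * (\<delta> ^ DIM(real ^ 'd) * I \<delta>)
          \<le> max A1 A2 * (1 - ln \<delta>) ^ DIM(real ^ 'd) * (\<delta> ^ DIM(real ^ 'd) * I \<delta>)"
        using \<delta> I_nonneg by (intro mult_right_mono) auto
      with bounds(2)[OF \<delta>] show "moment i q \<delta> \<le> max A1 A2 * (1 - ln \<delta>) ^ DIM(real ^ 'd) * (\<delta> ^ DIM(real ^ 'd) * Lq_integral (\<mu> i) q \<delta>)"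
        unfolding I_def by (rule order_trans)
    qed (use A in auto)
  next
    case False
    then have q1: "1 \<le> q"
      by simp
    obtain C where C: "C > 0" "\<And>\<delta>. 0 < \<delta> \<Longrightarrow> moment i q (2 * \<delta>) \<le> C * moment i q \<delta>"
      using moment_doubling[OF i q, of 2] by auto
    define A1 where "A1 = C / V 1"
    define A2 where "A2 = C * V (1 / 2)"
    have A: "0 < A1" "0 < A2"
      using V_pos C(1) by (auto simp: A1_def A2_def)
    have bounds: "\<delta> ^ DIM(real ^ 'd) * I \<delta> \<le> A1 * moment i q \<delta>"
      "moment i q \<delta> \<le> A2 * (\<delta> ^ DIM(real ^ 'd) * I \<delta>)"
      if \<delta>: "0 < \<delta>" for \<delta>
    proof -
      \<comment> \<open>In this case both comparisons are off by a factor 2 in the radius, repaired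
        by the doubling constant \<open>C\<close>.\<close>
      have "ennreal (V \<delta>) * J \<delta> \<le> ball_moment (\<mu> i) q (2 * \<delta>)"
        using le_ball_moment_of_one_le[OF q1 \<delta>] by (simp add: V_def J_def)
      from from_J[OF this] have *: "ennreal (I \<delta>) = J \<delta>" "V \<delta> * I \<delta> \<le> moment i q (2 * \<delta>)"
        using \<delta> by auto
      have "\<delta> ^ DIM(real ^ 'd) * V 1 * I \<delta> = V \<delta> * I \<delta>"
        using V_scale[of \<delta> 1] by simp
      also have "\<dots> \<le> C * moment i q \<delta>"
        using *(2) C(2)[OF \<delta>] by simp
      finally show "\<delta> ^ DIM(real ^ 'd) * I \<delta> \<le> A1 * moment i q \<delta>"
        using V_pos[of 1] by (simp add: A1_def field_simps)
      have V': "0 \<le> V (\<delta> / 2)"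
        using V_pos[of "\<delta> / 2"] \<delta> by simp
      have "ball_moment (\<mu> i) q (\<delta> / 2) \<le> ennreal (V (\<delta> / 2)) * J \<delta>"
        using ball_moment_le_of_one_le[OF q1, of "\<delta> / 2"] \<delta> by (simp add: V_def J_def)
      then have "ennreal (moment i q (\<delta> / 2)) \<le> ennreal (V (\<delta> / 2) * I \<delta>)"
        using i q V' by (simp add: ennreal_moment ennreal_mult I_nonneg *(1))
      then have "moment i q (\<delta> / 2) \<le> V (\<delta> / 2) * I \<delta>"
        using V' I_nonneg by (subst (asm) ennreal_le_iff) auto
      then have "C * moment i q (\<delta> / 2) \<le> C * (V (\<delta> / 2) * I \<delta>)"
        using C(1) by (intro mult_left_mono) auto
      also have "\<dots> = A2 * (\<delta> ^ DIM(real ^ 'd) * I \<delta>)"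
        using V_scale[of \<delta> "1 / 2"] by (simp add: A2_def mult_ac)
      finally show "moment i q \<delta> \<le> A2 * (\<delta> ^ DIM(real ^ 'd) * I \<delta>)"
        using C(2)[of "\<delta> / 2"] \<delta> by simp
    qed
    show ?thesis
    proof (intro exI[of _ "max A1 A2"] conjI allI impI)
      fix \<delta> :: real assume \<delta>: "0 < \<delta>" "\<delta> < 1"
      show "\<delta> ^ DIM(real ^ 'd) * Lq_integral (\<mu> i) q \<delta> \<le> max A1 A2 * moment i q \<delta>"
        using bounds(1)[OF \<delta>(1)] mult_right_mono[OF max.cobounded1[of A1 A2] moment_nonneg[of i q \<delta>]]
        unfolding I_def by (rule order_trans)
      \<comment> \<open>No logarithm is lost here; since \<open>1 - ln \<delta> \<ge> 1\<close>, the
        bound is merely weakened to the form shared with \<open>q \<le> 1\<close>.\<close>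
      have "A2 * 1 \<le> max A1 A2 * (1 - ln \<delta>) ^ DIM(real ^ 'd)"
        using \<delta> A by (intro mult_mono one_le_power) auto
      then have "A2 * (\<delta> ^ DIM(real ^ 'd) * I \<delta>)
          \<le> max A1 A2 * (1 - ln \<delta>) ^ DIM(real ^ 'd) * (\<delta> ^ DIM(real ^ 'd) * I \<delta>)"
        using \<delta> I_nonneg by (intro mult_right_mono) auto
      with bounds(2)[OF \<delta>(1)] show "moment i q \<delta> \<le> max A1 A2 * (1 - ln \<delta>) ^ DIM(real ^ 'd) * (\<delta> ^ DIM(real ^ 'd) * Lq_integral (\<mu> i) q \<delta>)"
        unfolding I_def by (rule order_trans)
    qed (use A in auto)
  qed
qed

lemma Lq_integral_comparable:
  assumes i: "i \<in> verts G" and j: "j \<in> verts G" and q: "0 \<le> q"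
  shows "\<exists>A>0. \<forall>\<delta>. 0 < \<delta> \<longrightarrow> \<delta> < 1 \<longrightarrow>
    \<delta> ^ DIM(real ^ 'd) * Lq_integral (\<mu> j) q \<delta> \<le> A * moment i q \<delta> \<and>
    moment i q \<delta> \<le> A * (1 - ln \<delta>) ^ DIM(real ^ 'd) * (\<delta> ^ DIM(real ^ 'd) * Lq_integral (\<mu> j) q \<delta>)"
proof -
  obtain A where A: "A > 0"
    "\<And>\<delta>. 0 < \<delta> \<Longrightarrow> \<delta> < 1 \<Longrightarrow> \<delta> ^ DIM(real ^ 'd) * Lq_integral (\<mu> j) q \<delta> \<le> A * moment j q \<delta>"
    "\<And>\<delta>. 0 < \<delta> \<Longrightarrow> \<delta> < 1 \<Longrightarrow>
      moment j q \<delta> \<le> A * (1 - ln \<delta>) ^ DIM(real ^ 'd) * (\<delta> ^ DIM(real ^ 'd) * Lq_integral (\<mu> j) q \<delta>)"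
    using Lq_integral_comparable_self[OF j q] by blast
  obtain C where C: "C > 0" "\<And>\<delta>. 0 < \<delta> \<Longrightarrow> moment j q \<delta> \<le> C * moment i q \<delta>"
    using moment_comparable[OF i j q] by blast
  obtain C' where C': "C' > 0" "\<And>\<delta>. 0 < \<delta> \<Longrightarrow> moment i q \<delta> \<le> C' * moment j q \<delta>"
    using moment_comparable[OF j i q] by blast
  define X where "X \<delta> = (1 - ln \<delta>) ^ DIM(real ^ 'd) * (\<delta> ^ DIM(real ^ 'd) * Lq_integral (\<mu> j) q \<delta>)" for \<delta> :: real
  have "\<delta> ^ DIM(real ^ 'd) * Lq_integral (\<mu> j) q \<delta> \<le> A * max C C' * moment i q \<delta>
      \<and> moment i q \<delta> \<le> A * max C C' * X \<delta>" if \<delta>: "0 < \<delta>" "\<delta> < 1" for \<delta>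
  proof
    have "\<delta> ^ DIM(real ^ 'd) * Lq_integral (\<mu> j) q \<delta> \<le> A * (C * moment i q \<delta>)"
      using A(2)[OF \<delta>] mult_left_mono[OF C(2)[OF \<delta>(1)], of A] A(1) by linarith
    also have "\<dots> \<le> A * (max C C' * moment i q \<delta>)"
      using A(1) moment_nonneg by (intro mult_left_mono mult_right_mono) auto
    finally show "\<delta> ^ DIM(real ^ 'd) * Lq_integral (\<mu> j) q \<delta> \<le> A * max C C' * moment i q \<delta>"
      by (simp add: mult.assoc)
    have "moment j q \<delta> \<le> A * X \<delta>"
      using A(3)[OF \<delta>] by (simp add: X_def mult.assoc)
    moreover from this have "0 \<le> A * X \<delta>"
      using moment_nonneg[of j q \<delta>] by linarith
    ultimately have "C' * moment j q \<delta> \<le> max C C' * (A * X \<delta>)"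
      using C' moment_nonneg by (intro mult_mono) auto
    then show "moment i q \<delta> \<le> A * max C C' * X \<delta>"
      using C'(2)[OF \<delta>(1)] by (simp add: mult_ac)
  qed
  then show ?thesis
    using A(1) C(1) unfolding X_def
    by (intro exI[of _ "A * max C C'"]) (auto simp: mult.assoc less_max_iff_disj)
qed

text \<open>The moment at a single vertex \<open>i\<close> controls the integrals at all vertices,
  so its exponent, shifted by the dimension, is the common limit.\<close>

lemma Lq_integral_exponent:
  assumes q: "0 \<le> q"
  shows "\<exists>L. \<forall>j\<in>verts G. ((\<lambda>\<delta>. ereal (ln (Lq_integral (\<mu> j) q \<delta>) / (- ln \<delta>))) \<longlongrightarrow> L) (at_right 0)"
proof -
  obtain i where i: "i \<in> verts G"
    using connected by (auto simp: strongly_connected_def)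
  obtain L where L: "((\<lambda>\<delta>. ereal (ln (moment i q \<delta>) / (- ln \<delta>))) \<longlongrightarrow> L) (at_right 0)"
    using moment_exponent[OF i q] by blast
  have "((\<lambda>\<delta>. ereal (ln (Lq_integral (\<mu> j) q \<delta>) / (- ln \<delta>))) \<longlongrightarrow> L + ereal (real DIM(real ^ 'd))) (at_right 0)"
    if j: "j \<in> verts G" for j
  proof -
    obtain A where A: "A > 0"
      "\<And>\<delta>. 0 < \<delta> \<Longrightarrow> \<delta> < 1 \<Longrightarrow> \<delta> ^ DIM(real ^ 'd) * Lq_integral (\<mu> j) q \<delta> \<le> A * moment i q \<delta>"
      "\<And>\<delta>. 0 < \<delta> \<Longrightarrow> \<delta> < 1 \<Longrightarrow>
        moment i q \<delta> \<le> A * (1 - ln \<delta>) ^ DIM(real ^ 'd) * (\<delta> ^ DIM(real ^ 'd) * Lq_integral (\<mu> j) q \<delta>)"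
      using Lq_integral_comparable[OF i j q] by blast
    show ?thesis
      using A(1) moment_pos[OF i q] A(2,3) L by (rule exponent_shift)
  qed
  then show ?thesis
    by blast
qed

end

theorem theorem2p1:
  fixes G :: "(nat, 'e) pre_digraph"
    and N :: nat
    and S :: "'e \<Rightarrow> real ^ 'd \<Rightarrow> real ^ 'd"
    and c p :: "'e \<Rightarrow> real"
    and \<mu> :: "nat \<Rightarrow> (real ^ 'd) measure"
  assumes "graph_directed_ifs G N S c p"
    and "graph_directed_self_similar_measures G N S p \<mu>"
  shows "\<forall>q \<ge> 0. \<forall>i \<in> verts G. \<forall>j \<in> verts G.
           lower_Lq_spectrum (\<mu> i) q = upper_Lq_spectrum (\<mu> i) q \<and>
           upper_Lq_spectrum (\<mu> i) q = lower_Lq_spectrum (\<mu> j) q \<and>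
           lower_Lq_spectrum (\<mu> j) q = upper_Lq_spectrum (\<mu> j) q"
proof (intro allI impI)
  fix q :: real assume q: "0 \<le> q"
  interpret graph_directed_measures G N S c p \<mu>
    using assms by (simp add: graph_directed_measures_def graph_directed_measures_axioms_def)
  obtain L where L: "\<And>j. j \<in> verts G \<Longrightarrow>
      ((\<lambda>\<delta>. ereal (ln (Lq_integral (\<mu> j) q \<delta>) / (- ln \<delta>))) \<longlongrightarrow> L) (at_right 0)"
    using Lq_integral_exponent[OF q] by blast
  have "lower_Lq_spectrum (\<mu> j) q = L" "upper_Lq_spectrum (\<mu> j) q = L" if "j \<in> verts G" for j
    unfolding lower_Lq_spectrum_def upper_Lq_spectrum_def
    using L[OF that] by (auto intro!: lim_imp_Liminf lim_imp_Limsup)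
  then show "\<forall>i \<in> verts G. \<forall>j \<in> verts G.
           lower_Lq_spectrum (\<mu> i) q = upper_Lq_spectrum (\<mu> i) q \<and>
           upper_Lq_spectrum (\<mu> i) q = lower_Lq_spectrum (\<mu> j) q \<and>
           lower_Lq_spectrum (\<mu> j) q = upper_Lq_spectrum (\<mu> j) q"
    by simp
qed

end
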